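(* Let $\beta>0$ and let $f_n:\mathbb{R}^n\to\mathbb{R}$, $n=1,2,\ldots$, be $(1/\sqrt n)$-Lipschitz functions (with respect to the Euclidean distance). Assume that, for a subsequence $\{f_{n_i}\}$ of $\{f_n\}$, the push-forward measures $(f_{n_i})_\#\nu^{n_i}_\beta$ converge weakly to a Borel probability measure $\mu$ on $\mathbb{R}$. Then there exists a $1$-Lipschitz function $\alpha:[0,\infty)\to\mathbb{R}$ such that $\alpha_\#\nu_\beta=\mu$.
   Context: For $\beta>0$, $\nu^n_\beta$ is the Borel probability measure on $\mathbb{R}^n$ $$\nu^n_\beta(dx)=\frac{\Gamma(\frac{n+\beta}{2})}{\pi^{n/2}\Gamma(\frac\beta2)}\frac{dx}{(1+\|x\|^2)^{\frac{n+\beta}{2}}},$$ and $\nu_\beta$ is the Borel probability measure on $[0,\infty)$ $$\nu_\beta(dt)=\frac{2^{1-\frac\beta2}}{\Gamma(\frac\beta2)}\,\frac{1}{t^{\beta+1}}\,e^{-\frac{1}{2t^2}}\,dt .$$ *)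

theory Defs
  imports "HOL-Probability.Probability"
begin

text \<open>
  The dimension \<open>n\<close> varies inside the statement, so \<open>\<real>\<^sup>n\<close> is represented by the functions
  \<^term>\<open>x \<in> {..<n} \<rightarrow>\<^sub>E (UNIV :: real set)\<close> (the value off \<^term>\<open>{..<n}\<close> being irrelevant and
  fixed to \<^term>\<open>undefined\<close>). The product of \<open>n\<close> copies of \<^term>\<open>lborel\<close> carries the
  Borel sets of \<open>\<real>\<^sup>n\<close> and \<open>n\<close>-dimensional Lebesgue measure, and the Euclidean norm of \<open>x\<close> is
  \<^term>\<open>L2_set x {..<n}\<close>.
\<close>

definition lebesgue_Rn :: "nat \<Rightarrow> (nat \<Rightarrow> real) measure" where
  "lebesgue_Rn n = Pi\<^sub>M {..<n} (\<lambda>_. lborel)"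

definition nu_Rn :: "nat \<Rightarrow> real \<Rightarrow> (nat \<Rightarrow> real) measure" where
  "nu_Rn n \<beta> = density (lebesgue_Rn n) (\<lambda>x. ennreal (
     Gamma ((real n + \<beta>) / 2) / (pi powr (real n / 2) * Gamma (\<beta> / 2)) *
     (1 / (1 + (L2_set x {..<n})\<^sup>2) powr ((real n + \<beta>) / 2))))"

text \<open>
  As a measure on \<open>[0,\<infty>)\<close>, its space is \<^term>\<open>{0..}\<close> with the trace of the Borel sets. The density
  below evaluates to \<open>0\<close> at the (null) point \<open>t = 0\<close>.
\<close>

definition nu_half_line :: "real \<Rightarrow> real measure" where
  "nu_half_line \<beta> = density (restrict_space lborel {0..}) (\<lambda>t. ennreal (
     2 powr (1 - \<beta> / 2) / Gamma (\<beta> / 2) * (1 / t powr (\<beta> + 1)) * exp (- (1 / (2 * t\<^sup>2)))))"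

text \<open>
  The type class based \<^const>\<open>lipschitz_on\<close> does not apply to \<open>\<real>\<^sup>n\<close> in this representation.
\<close>

definition lipschitz_Rn :: "nat \<Rightarrow> real \<Rightarrow> ((nat \<Rightarrow> real) \<Rightarrow> real) \<Rightarrow> bool" where
  "lipschitz_Rn n C f \<longleftrightarrow> 0 \<le> C \<and>
     (\<forall>x \<in> {..<n} \<rightarrow>\<^sub>E UNIV. \<forall>y \<in> {..<n} \<rightarrow>\<^sub>E UNIV.
        \<bar>f x - f y\<bar> \<le> C * L2_set (\<lambda>i. x i - y i) {..<n})"

end

theory Submission
  imports Defs "HOL-Complex_Analysis.Great_Picard"
begin

text \<open>
  The measure \<open>\<nu>\<^sup>n\<^sub>\<beta>\<close> is the law of \<open>t z\<close>, where \<open>t\<close> has law \<open>\<nu>\<^sub>\<beta>\<close> and \<open>z\<close> is an independent standard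
  Gaussian vector in \<open>\<real>\<^sup>n\<close>. By Gaussian concentration, \<open>z \<mapsto> f\<^sub>n(t z)\<close>, which is \<open>(t / \<surd>n)\<close>-Lipschitz, is
  close to its mean \<open>a\<^sub>n(t)\<close>, and \<open>a\<^sub>n\<close> is \<open>1\<close>-Lipschitz because \<open>E \<parallel>z\<parallel> \<le> \<surd>n\<close>. Weak convergence keeps
  \<open>a\<^sub>n(0) = f\<^sub>n(0)\<close> bounded along the subsequence, so a further subsequence of \<open>a\<^sub>n\<close> converges
  pointwise to some \<open>\<alpha>\<close>; comparing characteristic functions identifies \<open>\<mu>\<close> with the law of \<open>\<alpha>(t)\<close>.

  For the dimension-free concentration bound, replace the Lipschitz function by its Moreau envelope \<open>g\<close>, which
  is uniformly close and has a supergradient \<open>p\<close> of bounded norm everywhere. For independent Gaussian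
  vectors \<open>X\<close>, \<open>Y\<close>, join \<open>X\<close> to \<open>Y\<close> by the rotation arc \<open>cos \<theta> X + sin \<theta> Y\<close>. By rotation invariance
  each small step has the law of a step starting at \<open>X\<close> in the independent direction \<open>Y\<close>, where
  \<open>E (p \<bullet> Y)\<^sup>2 = \<parallel>p\<parallel>\<^sup>2\<close> does not depend on the dimension; positive and negative parts of the increment are
  estimated from the two endpoints of the step.
\<close>

section \<open>Product measures and Gaussian rotations\<close>

text \<open>The preimage of a box under a coordinatewise map is again a box, and a product measure
  is determined by its values on boxes. Sigma-finiteness of the images is a separate hypothesis
  because it does not pass from a measure to its image.\<close>

lemma PiM_distr:
  assumes I: "finite I"
    and M: "\<And>i. sigma_finite_measure (M i)"
    and f[measurable]: "\<And>i. i \<in> I \<Longrightarrow> f i \<in> measurable (M i) (N i)"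
    and N: "\<And>i. sigma_finite_measure (distr (M i) (N i) (f i))"
  shows "distr (PiM I M) (PiM I N) (\<lambda>x. \<lambda>i\<in>I. f i (x i)) = PiM I (\<lambda>i. distr (M i) (N i) (f i))"
proof -
  interpret M: product_sigma_finite M by (simp add: product_sigma_finite_def M)
  interpret D: product_sigma_finite "\<lambda>i. distr (M i) (N i) (f i)" by (simp add: product_sigma_finite_def N)
  show ?thesis
  proof (rule D.PiM_eqI[OF I])
    show "sets (distr (PiM I M) (PiM I N) (\<lambda>x. \<lambda>i\<in>I. f i (x i))) = sets (PiM I (\<lambda>i. distr (M i) (N i) (f i)))"
      by (simp cong: sets_PiM_cong)
    fix A assume A: "\<And>i. i \<in> I \<Longrightarrow> A i \<in> sets (distr (M i) (N i) (f i))"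
    have pre: "(\<lambda>x. \<lambda>i\<in>I. f i (x i)) -` Pi\<^sub>E I A \<inter> space (PiM I M) = Pi\<^sub>E I (\<lambda>i. f i -` A i \<inter> space (M i))"
      by (auto simp: space_PiM PiE_iff extensional_def)
    have "emeasure (distr (PiM I M) (PiM I N) (\<lambda>x. \<lambda>i\<in>I. f i (x i))) (Pi\<^sub>E I A)
        = emeasure (PiM I M) (Pi\<^sub>E I (\<lambda>i. f i -` A i \<inter> space (M i)))"
      using A I by (subst emeasure_distr) (auto simp: pre intro!: sets_PiM_I_finite measurable_restrict)
    also have "\<dots> = (\<Prod>i\<in>I. emeasure (M i) (f i -` A i \<inter> space (M i)))"
      using A I by (intro M.emeasure_PiM) (auto intro!: measurable_sets)
    also have "\<dots> = (\<Prod>i\<in>I. emeasure (distr (M i) (N i) (f i)) (A i))"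
      using A by (intro prod.cong) (auto simp: emeasure_distr f)
    finally show "emeasure (distr (PiM I M) (PiM I N) (\<lambda>x. \<lambda>i\<in>I. f i (x i))) (Pi\<^sub>E I A)
        = (\<Prod>i\<in>I. emeasure (distr (M i) (N i) (f i)) (A i))" .
  qed
qed

text \<open>On a box, the product of the densities times the indicator of the box factors over the
  coordinates, so the integral becomes a product of one-dimensional ones.\<close>

lemma PiM_density:
  fixes f :: "'i \<Rightarrow> 'a \<Rightarrow> ennreal"
  assumes I: "finite I"
    and M: "\<And>i. sigma_finite_measure (M i)"
    and f[measurable]: "\<And>i. f i \<in> borel_measurable (M i)"
    and D: "\<And>i. sigma_finite_measure (density (M i) (f i))"
  shows "PiM I (\<lambda>i. density (M i) (f i)) = density (PiM I M) (\<lambda>x. \<Prod>i\<in>I. f i (x i))"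
proof -
  interpret M: product_sigma_finite M by (simp add: product_sigma_finite_def M)
  interpret D: product_sigma_finite "\<lambda>i. density (M i) (f i)" by (simp add: product_sigma_finite_def D)
  show ?thesis
  proof (rule D.PiM_eqI[OF I, symmetric])
    show "sets (density (PiM I M) (\<lambda>x. \<Prod>i\<in>I. f i (x i))) = sets (PiM I (\<lambda>i. density (M i) (f i)))"
      by (simp cong: sets_PiM_cong)
    fix A assume A: "\<And>i. i \<in> I \<Longrightarrow> A i \<in> sets (density (M i) (f i))"
    have "emeasure (density (PiM I M) (\<lambda>x. \<Prod>i\<in>I. f i (x i))) (Pi\<^sub>E I A)
        = (\<integral>\<^sup>+x. (\<Prod>i\<in>I. f i (x i)) * indicator (Pi\<^sub>E I A) x \<partial>PiM I M)"
      using A I by (intro emeasure_density) (auto intro!: sets_PiM_I_finite)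
    also have "\<dots> = (\<integral>\<^sup>+x. (\<Prod>i\<in>I. f i (x i) * indicator (A i) (x i)) \<partial>PiM I M)"
      using I by (intro nn_integral_cong)
        (auto simp: prod.distrib space_PiM PiE_iff indicator_def prod_zero_iff split: if_splits)
    also have "\<dots> = (\<Prod>i\<in>I. \<integral>\<^sup>+x. f i x * indicator (A i) x \<partial>M i)"
      using A I by (intro M.product_nn_integral_prod) auto
    also have "\<dots> = (\<Prod>i\<in>I. emeasure (density (M i) (f i)) (A i))"
      using A by (intro prod.cong) (auto simp: emeasure_density)
    finally show "emeasure (density (PiM I M) (\<lambda>x. \<Prod>i\<in>I. f i (x i))) (Pi\<^sub>E I A)
        = (\<Prod>i\<in>I. emeasure (density (M i) (f i)) (A i))" .
  qed
qed

section \<open>Lebesgue measure under translations, shears and rotations\<close>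

lemma nn_integral_PiM_lborel_translate:
  fixes c :: "'i \<Rightarrow> real"
  assumes I: "finite I" and h[measurable]: "h \<in> borel_measurable (PiM I (\<lambda>_. lborel))"
  shows "(\<integral>\<^sup>+x. h (\<lambda>i\<in>I. x i + c i) \<partial>PiM I (\<lambda>_. lborel)) = (\<integral>\<^sup>+x. h x \<partial>PiM I (\<lambda>_. lborel))"
proof -
  have *: "distr lborel lborel (\<lambda>x. x + a) = (lborel :: real measure)" for a :: real
    using lborel_distr_plus[of a] by (simp add: add.commute cong: distr_cong)
  have "distr (PiM I (\<lambda>_. lborel)) (PiM I (\<lambda>_. lborel)) (\<lambda>x. \<lambda>i\<in>I. x i + c i) = PiM I (\<lambda>_. lborel :: real measure)"
    using PiM_distr[OF I, of "\<lambda>_. lborel" "\<lambda>i x. x + c i" "\<lambda>_. lborel"]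
    by (simp add: * sigma_finite_lborel)
  then have "(\<integral>\<^sup>+x. h x \<partial>PiM I (\<lambda>_. lborel))
     = (\<integral>\<^sup>+x. h x \<partial>distr (PiM I (\<lambda>_. lborel)) (PiM I (\<lambda>_. lborel)) (\<lambda>x. \<lambda>i\<in>I. x i + c i))"
    by simp
  also have "\<dots> = (\<integral>\<^sup>+x. h (\<lambda>i\<in>I. x i + c i) \<partial>PiM I (\<lambda>_. lborel))"
    by (intro nn_integral_distr) auto
  finally show ?thesis by simp
qed

lemma nn_integral_PiM_lborel_swap:
  assumes I: "finite I"
    and h[measurable]: "case_prod h \<in> borel_measurable (PiM I (\<lambda>_. lborel :: real measure) \<Otimes>\<^sub>M PiM I (\<lambda>_. lborel :: real measure))"
  shows "(\<integral>\<^sup>+x. \<integral>\<^sup>+y. h x y \<partial>PiM I (\<lambda>_. lborel) \<partial>PiM I (\<lambda>_. lborel)) =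
    (\<integral>\<^sup>+y. \<integral>\<^sup>+x. h x y \<partial>PiM I (\<lambda>_. lborel) \<partial>PiM I (\<lambda>_. lborel))"
proof -
  interpret product_sigma_finite "\<lambda>_::'a. lborel :: real measure"
    by (simp add: product_sigma_finite_def sigma_finite_lborel)
  interpret pair_sigma_finite "PiM I (\<lambda>_. lborel :: real measure)" "PiM I (\<lambda>_. lborel :: real measure)"
    by (simp add: pair_sigma_finite_def sigma_finite[OF I])
  show ?thesis using Fubini'[of h] by simp
qed

text \<open>For fixed x, a shear of y is a translation by \<open>a * x i\<close>. The other shear
  reduces to this one by exchanging the order of integration.\<close>

lemma nn_integral_PiM_lborel_shear:
  fixes a :: real
  assumes I: "finite I"
    and h[measurable]: "case_prod h \<in> borel_measurable (PiM I (\<lambda>_. lborel) \<Otimes>\<^sub>M PiM I (\<lambda>_. lborel))"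
  shows "(\<integral>\<^sup>+x. \<integral>\<^sup>+y. h x (\<lambda>i\<in>I. y i + a * x i) \<partial>PiM I (\<lambda>_. lborel) \<partial>PiM I (\<lambda>_. lborel)) =
      (\<integral>\<^sup>+x. \<integral>\<^sup>+y. h x y \<partial>PiM I (\<lambda>_. lborel) \<partial>PiM I (\<lambda>_. lborel))" (is ?A)
    and "(\<integral>\<^sup>+x. \<integral>\<^sup>+y. h (\<lambda>i\<in>I. x i + a * y i) y \<partial>PiM I (\<lambda>_. lborel) \<partial>PiM I (\<lambda>_. lborel)) =
      (\<integral>\<^sup>+x. \<integral>\<^sup>+y. h x y \<partial>PiM I (\<lambda>_. lborel) \<partial>PiM I (\<lambda>_. lborel))" (is ?B)
proof -
  have A: "(\<integral>\<^sup>+x. \<integral>\<^sup>+y. k x (\<lambda>i\<in>I. y i + a * x i) \<partial>PiM I (\<lambda>_. lborel) \<partial>PiM I (\<lambda>_. lborel)) =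
      (\<integral>\<^sup>+x. \<integral>\<^sup>+y. k x y \<partial>PiM I (\<lambda>_. lborel) \<partial>PiM I (\<lambda>_. lborel))"
    if [measurable]: "case_prod k \<in> borel_measurable (PiM I (\<lambda>_. lborel) \<Otimes>\<^sub>M PiM I (\<lambda>_. lborel))" for k
    by (intro nn_integral_cong nn_integral_PiM_lborel_translate I) measurable
  show ?A by (rule A) fact
  have "(\<integral>\<^sup>+x. \<integral>\<^sup>+y. h (\<lambda>i\<in>I. x i + a * y i) y \<partial>PiM I (\<lambda>_. lborel) \<partial>PiM I (\<lambda>_. lborel)) =
    (\<integral>\<^sup>+y. \<integral>\<^sup>+x. h (\<lambda>i\<in>I. x i + a * y i) y \<partial>PiM I (\<lambda>_. lborel) \<partial>PiM I (\<lambda>_. lborel))"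
    by (rule nn_integral_PiM_lborel_swap[OF I]) measurable
  also have "\<dots> = (\<integral>\<^sup>+y. \<integral>\<^sup>+x. h x y \<partial>PiM I (\<lambda>_. lborel) \<partial>PiM I (\<lambda>_. lborel))"
    by (rule A[where k="\<lambda>x y. h y x"]) measurable
  also have "\<dots> = (\<integral>\<^sup>+x. \<integral>\<^sup>+y. h x y \<partial>PiM I (\<lambda>_. lborel) \<partial>PiM I (\<lambda>_. lborel))"
    by (rule nn_integral_PiM_lborel_swap[OF I, symmetric]) measurable
  finally show ?B .
qed

text \<open>A rotation by an angle other than \<open>\<pi>\<close> is a product of three shears.\<close>

lemma nn_integral_PiM_lborel_rotate:
  fixes c s :: real
  assumes I: "finite I" and cs: "c\<^sup>2 + s\<^sup>2 = 1" "c \<noteq> - 1"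
    and h[measurable]: "case_prod h \<in> borel_measurable (PiM I (\<lambda>_. lborel) \<Otimes>\<^sub>M PiM I (\<lambda>_. lborel))"
  shows "(\<integral>\<^sup>+x. \<integral>\<^sup>+y. h (\<lambda>i\<in>I. c * x i + s * y i) (\<lambda>i\<in>I. c * y i - s * x i) \<partial>PiM I (\<lambda>_. lborel) \<partial>PiM I (\<lambda>_. lborel)) =
      (\<integral>\<^sup>+x. \<integral>\<^sup>+y. h x y \<partial>PiM I (\<lambda>_. lborel) \<partial>PiM I (\<lambda>_. lborel))"
proof -
  let ?L = "PiM I (\<lambda>_. lborel :: real measure)"
  \<comment> \<open>With c and s the cosine and sine of an angle, a is the tangent of half that
    angle. The rotation is the composition of shears with coefficients a, - s and a; the condition
    on c keeps the denominator nonzero.\<close>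
  define a where "a = s / (1 + c)"
  have c1: "1 + c \<noteq> 0" using cs by (simp add: add_eq_0_iff)
  have a1: "1 - a * s = c"
  proof -
    have "a * s * (1 + c) = s\<^sup>2" using c1 by (simp add: a_def power2_eq_square)
    also have "\<dots> = (1 - c) * (1 + c)" using cs by (simp add: algebra_simps power2_eq_square)
    finally show ?thesis using c1 by simp
  qed
  have "a + c * a = a * (1 + c)" by (simp add: algebra_simps)
  then have a2: "a + c * a = s" using c1 by (simp add: a_def)
  \<comment> \<open>Each of k1, k2, k3 puts one more shear inside h, so k3 is h after all three, and
    the invariance is peeled off one shear at a time.\<close>
  define k1 where "k1 x y = h (\<lambda>i\<in>I. x i + a * y i) y" for x y
  define k2 where "k2 x y = k1 x (\<lambda>i\<in>I. y i + (- s) * x i)" for x y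
  define k3 where "k3 x y = k2 (\<lambda>i\<in>I. x i + a * y i) y" for x y
  have [measurable]: "case_prod k1 \<in> borel_measurable (?L \<Otimes>\<^sub>M ?L)" unfolding k1_def by measurable
  have [measurable]: "case_prod k2 \<in> borel_measurable (?L \<Otimes>\<^sub>M ?L)" unfolding k2_def by measurable
  have "(\<integral>\<^sup>+x. \<integral>\<^sup>+y. h x y \<partial>?L \<partial>?L) = (\<integral>\<^sup>+x. \<integral>\<^sup>+y. k3 x y \<partial>?L \<partial>?L)"
    unfolding k3_def
    by (subst nn_integral_PiM_lborel_shear[OF I, of k2], measurable, unfold k2_def,
        subst nn_integral_PiM_lborel_shear[OF I, of k1], measurable, unfold k1_def,
        subst nn_integral_PiM_lborel_shear[OF I, of h], measurable)
  moreover have "k3 x y = h (\<lambda>i\<in>I. c * x i + s * y i) (\<lambda>i\<in>I. c * y i - s * x i)" for x y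
  proof -
    have 1: "y i + - s * (x i + a * y i) = c * y i - s * x i" for i
      unfolding a1[symmetric] by (simp add: algebra_simps)
    have 2: "x i + a * y i + a * (c * y i - s * x i) = c * x i + s * y i" for i
    proof -
      have "x i + a * y i + a * (c * y i - s * x i) = (1 - a * s) * x i + (a + c * a) * y i"
        by (simp add: algebra_simps)
      then show ?thesis by (simp only: a1 a2)
    qed
    show ?thesis
      unfolding k3_def k2_def k1_def
      by (intro arg_cong2[where f=h] restrict_ext) (simp_all only: restrict_apply if_True 1 2)
  qed
  ultimately show ?thesis by simp
qed

section \<open>Standard Gaussian vectors and their rotation invariance\<close>

abbreviation gauss :: "'i set \<Rightarrow> ('i \<Rightarrow> real) measure" where
  "gauss I \<equiv> PiM I (\<lambda>_. std_normal_distribution)"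

lemma prob_space_gauss: "prob_space (gauss I)"
  by (intro prob_space_PiM prob_space_normal_density) simp

lemma sets_gauss [measurable_cong, simp]: "sets (gauss I) = sets (PiM I (\<lambda>_. lborel))"
  by (intro sets_PiM_cong) auto

lemma gauss_eq_density:
  assumes I: "finite I"
  shows "gauss I = density (PiM I (\<lambda>_. lborel))
    (\<lambda>x. ennreal ((1 / sqrt (2 * pi)) ^ card I * exp (- (\<Sum>i\<in>I. (x i)\<^sup>2) / 2)))"
proof -
  have "gauss I = density (PiM I (\<lambda>_. lborel)) (\<lambda>x. \<Prod>i\<in>I. ennreal (std_normal_density (x i)))"
    by (intro PiM_density I sigma_finite_lborel)
      (auto intro!: prob_space_imp_sigma_finite prob_space_normal_density)
  also have "\<dots> = density (PiM I (\<lambda>_. lborel))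
    (\<lambda>x. ennreal ((1 / sqrt (2 * pi)) ^ card I * exp (- (\<Sum>i\<in>I. (x i)\<^sup>2) / 2)))"
    by (intro arg_cong2[where f=density] refl ext, subst prod_ennreal)
       (simp_all add: std_normal_density_def prod_dividef I exp_sum sum_negf[symmetric] sum_divide_distrib
         power_one_over divide_simps)
  finally show ?thesis .
qed

text \<open>The joint density of an independent pair depends only on the sum of the two squared
  norms. The rotation preserves this sum, and it preserves Lebesgue measure.\<close>

lemma nn_integral_gauss_rotate:
  fixes c s :: real
  assumes I: "finite I" and cs: "c\<^sup>2 + s\<^sup>2 = 1" "c \<noteq> - 1"
    and h[measurable]: "case_prod h \<in> borel_measurable (PiM I (\<lambda>_. lborel) \<Otimes>\<^sub>M PiM I (\<lambda>_. lborel))"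
  shows "(\<integral>\<^sup>+x. \<integral>\<^sup>+y. h (\<lambda>i\<in>I. c * x i + s * y i) (\<lambda>i\<in>I. c * y i - s * x i) \<partial>gauss I \<partial>gauss I) =
      (\<integral>\<^sup>+x. \<integral>\<^sup>+y. h x y \<partial>gauss I \<partial>gauss I)"
proof -
  let ?L = "PiM I (\<lambda>_. lborel :: real measure)"
  let ?C = "(1 / sqrt (2 * pi)) ^ card I"
  let ?q = "\<lambda>x. \<Sum>i\<in>I. (x i)\<^sup>2"
  interpret product_sigma_finite "\<lambda>_::'a. lborel :: real measure"
    by (simp add: product_sigma_finite_def sigma_finite_lborel)
  interpret L: sigma_finite_measure ?L by (rule sigma_finite[OF I])
  \<comment> \<open>Gathering the two densities into one weight in \<open>?q x + ?q y\<close> puts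
    the integral in the form to which the Lebesgue rotation applies.\<close>
  have double: "(\<integral>\<^sup>+x. \<integral>\<^sup>+y. k x y \<partial>gauss I \<partial>gauss I) =
     (\<integral>\<^sup>+x. \<integral>\<^sup>+y. ennreal (?C\<^sup>2 * exp (- (?q x + ?q y) / 2)) * k x y \<partial>?L \<partial>?L)"
    if [measurable]: "case_prod k \<in> borel_measurable (?L \<Otimes>\<^sub>M ?L)" for k
  proof -
    have "(\<integral>\<^sup>+x. \<integral>\<^sup>+y. k x y \<partial>gauss I \<partial>gauss I) = (\<integral>\<^sup>+x. ennreal (?C * exp (- ?q x / 2)) *
        (\<integral>\<^sup>+y. ennreal (?C * exp (- ?q y / 2)) * k x y \<partial>?L) \<partial>?L)"
    proof -
      have "(\<integral>\<^sup>+x. \<integral>\<^sup>+y. k x y \<partial>gauss I \<partial>gauss I) =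
          (\<integral>\<^sup>+x. (\<integral>\<^sup>+y. ennreal (?C * exp (- ?q y / 2)) * k x y \<partial>?L) \<partial>gauss I)"
      proof (rule nn_integral_cong)
        fix x assume "x \<in> space (gauss I)"
        then have [measurable]: "x \<in> space ?L" by (simp add: space_PiM)
        show "(\<integral>\<^sup>+y. k x y \<partial>gauss I) = (\<integral>\<^sup>+y. ennreal (?C * exp (- ?q y / 2)) * k x y \<partial>?L)"
          unfolding gauss_eq_density[OF I] by (rule nn_integral_density) measurable
      qed
      also have "\<dots> = (\<integral>\<^sup>+x. ennreal (?C * exp (- ?q x / 2)) *
          (\<integral>\<^sup>+y. ennreal (?C * exp (- ?q y / 2)) * k x y \<partial>?L) \<partial>?L)"
        unfolding gauss_eq_density[OF I] by (rule nn_integral_density) measurable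
      finally show ?thesis .
    qed
    also have "\<dots> = (\<integral>\<^sup>+x. \<integral>\<^sup>+y. ennreal (?C * exp (- ?q x / 2)) * (ennreal (?C * exp (- ?q y / 2)) * k x y) \<partial>?L \<partial>?L)"
      by (intro nn_integral_cong nn_integral_cmult[symmetric]) measurable
    also have "\<dots> = (\<integral>\<^sup>+x. \<integral>\<^sup>+y. ennreal (?C\<^sup>2 * exp (- (?q x + ?q y) / 2)) * k x y \<partial>?L \<partial>?L)"
    proof (intro nn_integral_cong)
      fix x y :: "'a \<Rightarrow> real"
      have "?C * exp (- ?q x / 2) * (?C * exp (- ?q y / 2)) = ?C\<^sup>2 * (exp (- ?q x / 2) * exp (- ?q y / 2))"
        by (simp add: power2_eq_square)
      also have "exp (- ?q x / 2) * exp (- ?q y / 2) = exp (- (?q x + ?q y) / 2)"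
        by (simp add: exp_add[symmetric] add_divide_distrib)
      finally have "?C * exp (- ?q x / 2) * (?C * exp (- ?q y / 2)) = ?C\<^sup>2 * exp (- (?q x + ?q y) / 2)" .
      then have "ennreal (?C * exp (- ?q x / 2)) * ennreal (?C * exp (- ?q y / 2))
          = ennreal (?C\<^sup>2 * exp (- (?q x + ?q y) / 2))"
        by (subst ennreal_mult[symmetric]) auto
      then show "ennreal (?C * exp (- ?q x / 2)) * (ennreal (?C * exp (- ?q y / 2)) * k x y)
          = ennreal (?C\<^sup>2 * exp (- (?q x + ?q y) / 2)) * k x y"
        by (simp only: mult.assoc[symmetric])
    qed
    finally show ?thesis .
  qed
  have q: "?q (\<lambda>i\<in>I. c * x i + s * y i) + ?q (\<lambda>i\<in>I. c * y i - s * x i) = ?q x + ?q y" for x y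
  proof -
    have "(c * a + s * b)\<^sup>2 + (c * b - s * a)\<^sup>2 = a\<^sup>2 + b\<^sup>2" for a b
    proof -
      have "(c * a + s * b)\<^sup>2 + (c * b - s * a)\<^sup>2 = (c\<^sup>2 + s\<^sup>2) * (a\<^sup>2 + b\<^sup>2)"
        by (simp add: power2_eq_square algebra_simps)
      then show ?thesis using cs by simp
    qed
    then show ?thesis by (simp add: sum.distrib[symmetric] cong: sum.cong)
  qed
  have "(\<integral>\<^sup>+x. \<integral>\<^sup>+y. h (\<lambda>i\<in>I. c * x i + s * y i) (\<lambda>i\<in>I. c * y i - s * x i) \<partial>gauss I \<partial>gauss I) =
    (\<integral>\<^sup>+x. \<integral>\<^sup>+y. ennreal (?C\<^sup>2 * exp (- (?q x + ?q y) / 2)) *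
      h (\<lambda>i\<in>I. c * x i + s * y i) (\<lambda>i\<in>I. c * y i - s * x i) \<partial>?L \<partial>?L)"
    by (rule double) measurable
  also have "\<dots> = (\<integral>\<^sup>+x. \<integral>\<^sup>+y. ennreal (?C\<^sup>2 * exp (- (?q x + ?q y) / 2)) * h x y \<partial>?L \<partial>?L)"
  proof -
    let ?k = "\<lambda>x y. ennreal (?C\<^sup>2 * exp (- (?q x + ?q y) / 2)) * h x y"
    have "case_prod ?k \<in> borel_measurable (?L \<Otimes>\<^sub>M ?L)" by measurable
    from nn_integral_PiM_lborel_rotate[OF I cs this] show ?thesis by (simp only: q)
  qed
  also have "\<dots> = (\<integral>\<^sup>+x. \<integral>\<^sup>+y. h x y \<partial>gauss I \<partial>gauss I)"
    by (rule double[symmetric]) measurable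
  finally show ?thesis .
qed

section \<open>Moreau envelopes and Gaussian concentration\<close>

text \<open>The bound is imposed on all functions, not only on extensional ones. It forces F to
  ignore coordinates outside I, so sums and multiples of vectors can be written without
  \<open>restrict\<close>.\<close>

definition lip1 :: "'i set \<Rightarrow> (('i \<Rightarrow> real) \<Rightarrow> real) \<Rightarrow> bool" where
  "lip1 I F \<longleftrightarrow> (\<forall>x y. \<bar>F x - F y\<bar> \<le> L2_set (\<lambda>i. x i - y i) I)"

lemma L2_set_power2: "(L2_set v I)\<^sup>2 = (\<Sum>i\<in>I. (v i)\<^sup>2)"
  by (simp add: L2_set_def sum_nonneg)

lemma lip1D: "lip1 I F \<Longrightarrow> \<bar>F x - F y\<bar> \<le> L2_set (\<lambda>i. x i - y i) I"
  by (simp add: lip1_def)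

lemma lip1_cong:
  assumes "lip1 I F" "\<And>i. i \<in> I \<Longrightarrow> x i = y i"
  shows "F x = F y"
proof -
  have "L2_set (\<lambda>i. x i - y i) I = 0" using assms(2) by (intro L2_set_0') auto
  with lip1D[OF assms(1), of x y] show ?thesis by simp
qed

text \<open>F is continuous for the product topology on the whole function space, hence Borel there.
  As the index type is countable, measurability of the coordinates makes the identity measurable
  from the product sigma-algebra to these Borel sets.\<close>

lemma lip1_measurable:
  fixes F :: "('i::countable \<Rightarrow> real) \<Rightarrow> real"
  assumes F: "lip1 I F"
  shows "F \<in> borel_measurable (PiM I (\<lambda>_. lborel))"
proof -
  have "continuous_on UNIV F"
  proof (rule continuous_at_imp_continuous_on, rule ballI)
    fix x :: "'i \<Rightarrow> real"
    have c: "isCont (\<lambda>y. y i) x" for i :: 'i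
    proof -
      have "continuous_on UNIV (\<lambda>y :: 'i \<Rightarrow> real. y i)" by (rule continuous_on_product_coordinates)
      then show ?thesis using continuous_on_eq_continuous_at[OF open_UNIV] by blast
    qed
    have "((\<lambda>y. L2_set (\<lambda>i. y i - x i) I) \<longlongrightarrow> L2_set (\<lambda>i. x i - x i) I) (at x)"
      unfolding L2_set_def using c by (intro tendsto_intros) (auto simp: isCont_def)
    then have "((\<lambda>y. L2_set (\<lambda>i. y i - x i) I) \<longlongrightarrow> 0) (at x)" by (simp add: L2_set_0')
    then have "((\<lambda>y. F y - F x) \<longlongrightarrow> 0) (at x)"
      by (rule Lim_null_comparison[rotated]) (simp add: lip1D[OF F])
    then show "isCont F x" by (simp add: isCont_def LIM_zero_iff)
  qed
  then have [measurable]: "F \<in> borel_measurable borel" by (rule borel_measurable_continuous_onI)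
  have "(\<lambda>x. x) \<in> borel_measurable (PiM I (\<lambda>_. lborel :: real measure))"
  proof (rule measurable_coordinatewise_then_product)
    fix i :: 'i
    show "(\<lambda>x. x i) \<in> borel_measurable (PiM I (\<lambda>_. lborel :: real measure))"
    proof (cases "i \<in> I")
      case True then show ?thesis by measurable
    next
      case False
      \<comment> \<open>Off I every point of the space has the value \<open>undefined\<close>, so
        this coordinate is constant.\<close>
      then have "(\<lambda>x. x i) \<in> borel_measurable (PiM I (\<lambda>_. lborel :: real measure)) \<longleftrightarrow>
        (\<lambda>x. undefined :: real) \<in> borel_measurable (PiM I (\<lambda>_. lborel :: real measure))"
        by (intro measurable_cong) (auto simp: space_PiM PiE_iff extensional_def)
      then show ?thesis by simp
    qed
  qed
  then have "(\<lambda>x. F x) \<in> borel_measurable (PiM I (\<lambda>_. lborel :: real measure))" by measurable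
  then show ?thesis by simp
qed

text \<open>
  The envelope is semiconcave, and this one-sided substitute for differentiability is all that the
  concentration argument needs.
\<close>

definition moreau :: "'i set \<Rightarrow> (('i \<Rightarrow> real) \<Rightarrow> real) \<Rightarrow> ('i \<Rightarrow> real) \<Rightarrow> real" where
  "moreau I F x = (INF v. F (\<lambda>i. x i + v i) + (L2_set v I)\<^sup>2)"

context
  fixes I :: "'i set" and F :: "('i \<Rightarrow> real) \<Rightarrow> real"
  assumes F: "lip1 I F"
begin

text \<open>Moving by a vector of length r lowers F by at most r and costs r^2, and r - r^2 is at
  most 1/4. This makes the infimum finite and keeps the envelope within 1/4 of F.\<close>

lemma moreau_aux: "F x - 1 / 4 \<le> F (\<lambda>i. x i + v i) + (L2_set v I)\<^sup>2"
proof -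
  have "F x - L2_set v I \<le> F (\<lambda>i. x i + v i)"
    using lip1D[OF F, of "\<lambda>i. x i + v i" x] by auto
  moreover have "0 \<le> (L2_set v I - 1 / 2)\<^sup>2" by simp
  ultimately show ?thesis by (simp add: power2_eq_square algebra_simps)
qed

lemma bdd_below_moreau: "bdd_below (range (\<lambda>v. F (\<lambda>i. x i + v i) + (L2_set v I)\<^sup>2))"
  by (rule bdd_belowI2[where m="F x - 1 / 4"]) (rule moreau_aux)

lemma moreau_le: "moreau I F x \<le> F (\<lambda>i. x i + v i) + (L2_set v I)\<^sup>2"
  unfolding moreau_def by (rule cINF_lower[OF bdd_below_moreau]) simp

lemma moreau_le_self: "moreau I F x \<le> F x"
  using moreau_le[of x "\<lambda>_. 0"] by (simp add: L2_set_0')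

lemma moreau_ge: "F x - 1 / 4 \<le> moreau I F x"
  unfolding moreau_def by (rule cINF_greatest) (auto intro: moreau_aux)

text \<open>For each fixed v the competitor is a translate of F plus a constant, hence 1-Lipschitz,
  and an infimum of such functions is 1-Lipschitz.\<close>

lemma moreau_lip1: "lip1 I (moreau I F)"
proof -
  have "moreau I F x \<le> moreau I F y + L2_set (\<lambda>i. x i - y i) I" for x y
  proof -
    have "moreau I F x - L2_set (\<lambda>i. x i - y i) I \<le> F (\<lambda>i. y i + v i) + (L2_set v I)\<^sup>2" for v
      using moreau_le[of x v] lip1D[OF F, of "\<lambda>i. x i + v i" "\<lambda>i. y i + v i"] by simp
    then have "moreau I F x - L2_set (\<lambda>i. x i - y i) I \<le> moreau I F y"
      unfolding moreau_def[of I F y] by (intro cINF_greatest) auto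
    then show ?thesis by simp
  qed
  moreover have "L2_set (\<lambda>i. x i - y i) I = L2_set (\<lambda>i. y i - x i) I" for x y :: "'i \<Rightarrow> real"
    by (simp add: L2_set_def power2_commute)
  ultimately show ?thesis unfolding lip1_def abs_le_iff by (metis diff_le_eq add.commute minus_diff_eq)
qed

text \<open>Take a near-minimiser v for x. From \<open>x + u\<close> the displacement
  \<open>v - u\<close> reaches the same point, so the envelope grows by at most the difference of
  the two squared norms, whose linear part in u has coefficient p = - 2 v. The slack \<eta> replaces
  attainment of the infimum.\<close>

lemma moreau_supergradient:
  assumes \<eta>: "0 < \<eta>" "\<eta> \<le> 2"
  obtains p where "L2_set p I \<le> 4"
    "\<And>u. moreau I F (\<lambda>i. x i + u i) \<le> moreau I F x + \<eta> + (\<Sum>i\<in>I. p i * u i) + (L2_set u I)\<^sup>2"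
proof -
  obtain v where v: "F (\<lambda>i. x i + v i) + (L2_set v I)\<^sup>2 < moreau I F x + \<eta>"
    using cINF_less_iff[OF _ bdd_below_moreau, of x "moreau I F x + \<eta>"] \<eta>
    by (auto simp: moreau_def[symmetric])
  have "F x - L2_set v I \<le> F (\<lambda>i. x i + v i)"
    using lip1D[OF F, of "\<lambda>i. x i + v i" x] by auto
  \<comment> \<open>For r the norm of v, near-minimality gives r^2 \<le> r + \<eta> \<le> r + 2,
    that is (r - 2)(r + 1) \<le> 0. So r \<le> 2, which is the origin of the bound 4 on p.\<close>
  then have "(L2_set v I)\<^sup>2 \<le> L2_set v I + 2" using v moreau_le_self[of x] \<eta> by simp
  then have v2: "L2_set v I \<le> 2"
  proof -
    have "(L2_set v I - 2) * (L2_set v I + 1) \<le> 0"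
      using \<open>(L2_set v I)\<^sup>2 \<le> L2_set v I + 2\<close> by (simp add: power2_eq_square algebra_simps)
    moreover have "0 < L2_set v I + 1" by (simp add: add_nonneg_pos)
    ultimately show ?thesis by (simp add: mult_le_0_iff)
  qed
  show thesis
  proof (rule that[of "\<lambda>i. - 2 * v i"])
    have "L2_set (\<lambda>i. - 2 * v i) I = 2 * L2_set v I"
      by (simp add: L2_set_def power_mult_distrib sum_distrib_left[symmetric] real_sqrt_mult)
    then show "L2_set (\<lambda>i. - 2 * v i) I \<le> 4" using v2 by simp
    fix u
    have "(L2_set (\<lambda>i. v i - u i) I)\<^sup>2 = (L2_set v I)\<^sup>2 + (\<Sum>i\<in>I. (- 2 * v i) * u i) + (L2_set u I)\<^sup>2"
      unfolding L2_set_power2 sum.distrib[symmetric]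
      by (intro sum.cong) (auto simp: power2_eq_square algebra_simps)
    moreover have "moreau I F (\<lambda>i. x i + u i) \<le> F (\<lambda>i. x i + v i) + (L2_set (\<lambda>i. v i - u i) I)\<^sup>2"
      using moreau_le[of "\<lambda>i. x i + u i" "\<lambda>i. v i - u i"] by simp
    ultimately show "moreau I F (\<lambda>i. x i + u i) \<le> moreau I F x + \<eta> + (\<Sum>i\<in>I. (- 2 * v i) * u i) + (L2_set u I)\<^sup>2"
      using v by linarith
  qed
qed

end

section \<open>Moments of Gaussian coordinates and of linear forms\<close>

lemma
  fixes h :: "real \<Rightarrow> real"
  assumes i: "i \<in> I" and [measurable]: "h \<in> borel_measurable borel"
  shows integral_gauss_component: "(\<integral>x. h (x i) \<partial>gauss I) = (\<integral>x. h x \<partial>std_normal_distribution)"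
    and integrable_gauss_component: "integrable std_normal_distribution h \<Longrightarrow> integrable (gauss I) (\<lambda>x. h (x i))"
proof -
  have d: "distr (gauss I) std_normal_distribution (\<lambda>x. x i) = std_normal_distribution"
    by (rule distr_PiM_component[OF prob_space_normal_density i]) simp
  have "(\<lambda>x. x i) \<in> measurable (gauss I) std_normal_distribution"
    by (rule measurable_component_singleton[OF i])
  then have [measurable, simp]: "(\<lambda>x. x i) \<in> borel_measurable (gauss I)" by simp
  show "(\<integral>x. h (x i) \<partial>gauss I) = (\<integral>x. h x \<partial>std_normal_distribution)"
    by (subst d[symmetric], subst integral_distr) auto
  show "integrable (gauss I) (\<lambda>x. h (x i))" if "integrable std_normal_distribution h"
    using that by (subst (asm) d[symmetric], subst (asm) integrable_distr_eq) auto
qed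

text \<open>In the expanded square the off-diagonal terms vanish, since the coordinates are
  independent and centred, and the diagonal ones have variance one.\<close>

lemma has_bochner_integral_gauss_linear_sq:
  fixes p :: "'i \<Rightarrow> real"
  assumes I: "finite I"
  shows "has_bochner_integral (gauss I) (\<lambda>x. (\<Sum>i\<in>I. p i * x i)\<^sup>2) (\<Sum>i\<in>I. (p i)\<^sup>2)"
proof -
  interpret N: product_sigma_finite "\<lambda>_::'i. std_normal_distribution"
    by (auto simp: product_sigma_finite_def intro!: prob_space_imp_sigma_finite prob_space_normal_density)
  have cov: "has_bochner_integral (gauss I) (\<lambda>x. x i * x j) (if i = j then 1 else 0)" if ij: "i \<in> I" "j \<in> I" for i j
  proof (cases "i = j")
    case True
    then show ?thesis
      using integrable_gauss_component[OF ij(1), of "\<lambda>x. x ^ 2"] integral_gauss_component[OF ij(1), of "\<lambda>x. x ^ 2"]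
        std_normal_distribution_even_moments[of 1]
      by (simp add: has_bochner_integral_iff power2_eq_square)
  next
    case False
    \<comment> \<open>All factors other than those at i and j are the constant 1, so the product
      formula over I computes a mixed moment; the factor at i is a vanishing odd moment.\<close>
    define f :: "'i \<Rightarrow> real \<Rightarrow> real" where "f k x = (if k = i \<or> k = j then x else 1)" for k x
    have int: "integrable std_normal_distribution (f k)" for k
      using integrable_std_normal_distribution_moment[of 1] integrable_std_normal_distribution_moment[of 0]
      by (cases "k = i \<or> k = j") (auto simp: f_def[abs_def])
    have prod: "(\<Prod>k\<in>I. f k (x k)) = x i * x j" for x
    proof -
      have "(\<Prod>k\<in>I. f k (x k)) = (\<Prod>k\<in>{i, j}. f k (x k))"
        using I ij by (intro prod.mono_neutral_right) (auto simp: f_def)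
      also have "\<dots> = x i * x j" using False by (simp add: f_def)
      finally show ?thesis .
    qed
    have "(\<integral>x. x i * x j \<partial>gauss I) = (\<Prod>k\<in>I. \<integral>x. f k x \<partial>std_normal_distribution)"
      using N.product_integral_prod[OF I, of f] int by (simp add: prod)
    also have "\<dots> = 0"
      using I ij integral_std_normal_distribution_moment_odd[of 1] by (intro prod_zero bexI[of _ i]) (auto simp: f_def)
    finally show ?thesis
      using N.product_integrable_prod[OF I, of f] int False by (simp add: prod has_bochner_integral_iff)
  qed
  have "has_bochner_integral (gauss I) (\<lambda>x. \<Sum>i\<in>I. \<Sum>j\<in>I. p i * p j * (x i * x j))
      (\<Sum>i\<in>I. \<Sum>j\<in>I. p i * p j * (if i = j then 1 else 0))"
    by (intro has_bochner_integral_sum has_bochner_integral_mult_right cov)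
  moreover have "(\<Sum>i\<in>I. \<Sum>j\<in>I. p i * p j * (if i = j then 1 else 0)) = (\<Sum>i\<in>I. (p i)\<^sup>2)"
    by (intro sum.cong) (simp_all add: I power2_eq_square if_distrib sum.delta cong: if_cong)
  moreover have "(\<Sum>i\<in>I. \<Sum>j\<in>I. p i * p j * (x i * x j)) = (\<Sum>i\<in>I. p i * x i)\<^sup>2" for x :: "'i \<Rightarrow> real"
    unfolding power2_eq_square sum_product by (intro sum.cong refl) (simp add: algebra_simps)
  ultimately show ?thesis by simp
qed

section \<open>Increments of the envelope along a rotation arc\<close>

context
  fixes I :: "'i::countable set" and F :: "('i \<Rightarrow> real) \<Rightarrow> real"
  assumes I: "finite I" and F: "lip1 I F"
begin

text \<open>By Cauchy-Schwarz this dominates the fourth power of the norm, and it is a sum over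
  single coordinates, so its integrability is one-dimensional. Its mean depends on the dimension,
  but it enters only with the factor \<theta>^4 and disappears as the steps shrink.\<close>

definition quartic :: "('i \<Rightarrow> real) \<Rightarrow> real" where "quartic x = real (card I) * (\<Sum>i\<in>I. (x i) ^ 4)"

definition quartic_mean :: real where "quartic_mean = (\<integral>x. quartic x \<partial>gauss I)"

interpretation G: prob_space "gauss I" by (rule prob_space_gauss)

private abbreviation g where "g \<equiv> moreau I F"

lemma integrable_quartic: "integrable (gauss I) quartic"
  unfolding quartic_def[abs_def]
  by (intro Bochner_Integration.integrable_mult_right Bochner_Integration.integrable_sum
      integrable_gauss_component[where h="\<lambda>x. x ^ 4"] integrable_std_normal_distribution_moment) auto

lemma quartic_nonneg: "0 \<le> quartic x" by (simp add: quartic_def sum_nonneg)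

lemma quartic_mean_nonneg: "0 \<le> quartic_mean" by (simp add: quartic_mean_def quartic_nonneg)

lemma L2_set_power4_le: "(L2_set x I) ^ 4 \<le> quartic x"
proof -
  have "(L2_set x I) ^ 4 = (\<Sum>i\<in>I. (x i)\<^sup>2)\<^sup>2"
    by (simp add: L2_set_power2[symmetric])
  also have "\<dots> \<le> (\<Sum>i\<in>I. ((x i)\<^sup>2)\<^sup>2) * card I" by (rule sum_squared_le_sum_of_squares)
  finally show ?thesis by (simp add: quartic_def mult.commute)
qed

lemma moreau_measurable [measurable]: "g \<in> borel_measurable (PiM I (\<lambda>_. lborel))"
  by (intro lip1_measurable moreau_lip1 F)

lemma moreau_restrict: "g (\<lambda>i\<in>I. f i) = g f"
  by (rule lip1_cong[OF moreau_lip1[OF F]]) simp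

lemma power2_sum_le: "(a + b)\<^sup>2 \<le> 2 * a\<^sup>2 + 2 * (b :: real)\<^sup>2"
  using zero_le_power2[of "a - b"] by (simp add: power2_eq_square algebra_simps)

text \<open>The supergradient inequality is applied to the displacement u with slack \<theta>^2. Its
  main term is sin \<theta> times the linear form in y; all other terms are of second order in
  \<theta>. Only the positive part is controlled because the inequality is one-sided.\<close>

lemma increment_pointwise:
  fixes \<theta> :: real
  assumes \<theta>: "\<theta> \<noteq> 0" "\<bar>\<theta>\<bar> \<le> 1" and p4: "L2_set p I \<le> 4"
    and p: "\<And>u. g (\<lambda>i. x i + u i) \<le> g x + \<theta>\<^sup>2 + (\<Sum>i\<in>I. p i * u i) + (L2_set u I)\<^sup>2"
  shows "(max 0 (g (\<lambda>i. cos \<theta> * x i + sin \<theta> * y i) - g x))\<^sup>2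
    \<le> 2 * \<theta>\<^sup>2 * (\<Sum>i\<in>I. p i * y i)\<^sup>2 + 24 * \<theta> ^ 4 * (1 + quartic x + quartic y)"
proof -
  define u where "u i = (cos \<theta> - 1) * x i + sin \<theta> * y i" for i
  \<comment> \<open>D collects the coefficients of \<theta>^2: 1 from the slack, one plus the
    squared norm of x from the cosine term, and the squared norm of x plus twice that of y from
    u.\<close>
  define D where "D = 2 * (1 + (L2_set x I)\<^sup>2 + (L2_set y I)\<^sup>2)"
  let ?py = "\<Sum>i\<in>I. p i * y i" and ?px = "\<Sum>i\<in>I. p i * x i"
  have s: "\<bar>sin \<theta>\<bar> \<le> \<bar>\<theta>\<bar>" by (rule abs_sin_x_le_abs_x)
  have c: "\<bar>cos \<theta> - 1\<bar> \<le> \<theta>\<^sup>2 / 2"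
  proof -
    have "\<bar>cos \<theta> - 1\<bar> = 2 * \<bar>sin (\<theta> / 2)\<bar>\<^sup>2" using cos_double_sin[of "\<theta> / 2"] by simp
    also have "\<dots> \<le> 2 * \<bar>\<theta> / 2\<bar>\<^sup>2" by (intro mult_left_mono power_mono abs_sin_x_le_abs_x) auto
    finally show ?thesis by (simp add: power2_eq_square)
  qed
  have gu: "g (\<lambda>i. cos \<theta> * x i + sin \<theta> * y i) - g x \<le> \<theta>\<^sup>2 + (\<Sum>i\<in>I. p i * u i) + (L2_set u I)\<^sup>2"
  proof -
    have "(\<lambda>i. cos \<theta> * x i + sin \<theta> * y i) = (\<lambda>i. x i + u i)" by (simp add: u_def algebra_simps)
    with p[of u] show ?thesis by simp
  qed
  have pu: "(\<Sum>i\<in>I. p i * u i) = (cos \<theta> - 1) * ?px + sin \<theta> * ?py"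
    by (simp add: u_def sum.distrib[symmetric] sum_distrib_left algebra_simps)
  have "\<bar>?px\<bar> \<le> 4 * L2_set x I"
  proof -
    have "\<bar>?px\<bar> \<le> (\<Sum>i\<in>I. \<bar>p i\<bar> * \<bar>x i\<bar>)" by (simp add: abs_mult[symmetric] sum_abs)
    also have "\<dots> \<le> L2_set p I * L2_set x I" by (rule L2_set_mult_ineq)
    also have "\<dots> \<le> 4 * L2_set x I" by (intro mult_right_mono p4) simp
    finally show ?thesis .
  qed
  also have "4 * L2_set x I \<le> 2 * (1 + (L2_set x I)\<^sup>2)"
    using zero_le_power2[of "L2_set x I - 1"] by (simp add: power2_eq_square algebra_simps)
  finally have "\<bar>?px\<bar> \<le> 2 * (1 + (L2_set x I)\<^sup>2)" .
  then have "\<bar>cos \<theta> - 1\<bar> * \<bar>?px\<bar> \<le> (\<theta>\<^sup>2 / 2) * (2 * (1 + (L2_set x I)\<^sup>2))"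
    using c by (intro mult_mono) auto
  also have "\<dots> = \<theta>\<^sup>2 * (1 + (L2_set x I)\<^sup>2)" by simp
  finally have 1: "(cos \<theta> - 1) * ?px \<le> \<theta>\<^sup>2 * (1 + (L2_set x I)\<^sup>2)"
    unfolding abs_mult[symmetric] by linarith
  have 2: "sin \<theta> * ?py \<le> \<bar>\<theta>\<bar> * \<bar>?py\<bar>"
  proof -
    have "sin \<theta> * ?py \<le> \<bar>sin \<theta>\<bar> * \<bar>?py\<bar>" unfolding abs_mult[symmetric] by (rule abs_ge_self)
    also have "\<dots> \<le> \<bar>\<theta>\<bar> * \<bar>?py\<bar>" by (intro mult_right_mono s) simp
    finally show ?thesis .
  qed
  have \<theta>2: "\<theta>\<^sup>2 \<le> 1" using \<theta> by (simp add: abs_square_le_1)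
  have 3: "(L2_set u I)\<^sup>2 \<le> \<theta>\<^sup>2 * (L2_set x I)\<^sup>2 + 2 * \<theta>\<^sup>2 * (L2_set y I)\<^sup>2"
  proof -
    have "(u i)\<^sup>2 \<le> \<theta>\<^sup>2 * (x i)\<^sup>2 + 2 * \<theta>\<^sup>2 * (y i)\<^sup>2" for i
    proof -
      have "(u i)\<^sup>2 \<le> 2 * ((cos \<theta> - 1) * x i)\<^sup>2 + 2 * (sin \<theta> * y i)\<^sup>2"
        unfolding u_def by (rule power2_sum_le)
      moreover have "((cos \<theta> - 1) * x i)\<^sup>2 \<le> \<theta>\<^sup>2 / 2 * (x i)\<^sup>2"
      proof -
        have "(cos \<theta> - 1)\<^sup>2 \<le> (\<theta>\<^sup>2 / 2)\<^sup>2"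
          using power_mono[OF c abs_ge_zero, of 2] unfolding power2_abs .
        also have "\<dots> = \<theta>\<^sup>2 * \<theta>\<^sup>2 / 4" by (simp add: power2_eq_square)
        also have "\<dots> \<le> \<theta>\<^sup>2 * 1 / 4" by (intro divide_right_mono mult_left_mono \<theta>2) auto
        also have "\<dots> \<le> \<theta>\<^sup>2 / 2" by simp
        finally show ?thesis unfolding power_mult_distrib by (rule mult_right_mono) simp
      qed
      moreover have "(sin \<theta> * y i)\<^sup>2 \<le> \<theta>\<^sup>2 * (y i)\<^sup>2"
        unfolding power_mult_distrib using s by (intro mult_right_mono) (simp_all add: abs_le_square_iff)
      ultimately show ?thesis by linarith
    qed
    then show ?thesis
      by (simp add: L2_set_power2 sum_distrib_left sum.distrib[symmetric] sum_mono)
  qed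
  have D2: "D\<^sup>2 \<le> 12 * (1 + quartic x + quartic y)"
  proof -
    have "D\<^sup>2 = 4 * (1 + (L2_set x I)\<^sup>2 + (L2_set y I)\<^sup>2)\<^sup>2" unfolding D_def power_mult_distrib by simp
    also have "\<dots> \<le> 4 * (3 * (1 + (L2_set x I) ^ 4 + (L2_set y I) ^ 4))"
    proof -
      have "(1 + a + b)\<^sup>2 \<le> 3 * (1 + a\<^sup>2 + b\<^sup>2)" for a b :: real
        using zero_le_power2[of "a - 1"] zero_le_power2[of "b - 1"] zero_le_power2[of "a - b"]
        by (simp add: power2_eq_square algebra_simps)
      from this[of "(L2_set x I)\<^sup>2" "(L2_set y I)\<^sup>2"] show ?thesis by simp
    qed
    also have "\<dots> \<le> 4 * (3 * (1 + quartic x + quartic y))" by (intro mult_left_mono add_mono L2_set_power4_le) auto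
    finally show ?thesis by simp
  qed
  have "g (\<lambda>i. cos \<theta> * x i + sin \<theta> * y i) - g x \<le> \<bar>\<theta>\<bar> * \<bar>?py\<bar> + \<theta>\<^sup>2 * D"
    using gu pu 1 2 3 by (simp add: D_def algebra_simps)
  moreover have "0 \<le> \<bar>\<theta>\<bar> * \<bar>?py\<bar> + \<theta>\<^sup>2 * D" by (simp add: D_def)
  ultimately have "(max 0 (g (\<lambda>i. cos \<theta> * x i + sin \<theta> * y i) - g x))\<^sup>2 \<le> (\<bar>\<theta>\<bar> * \<bar>?py\<bar> + \<theta>\<^sup>2 * D)\<^sup>2"
    by (intro power_mono) auto
  also have "\<dots> \<le> 2 * (\<bar>\<theta>\<bar> * \<bar>?py\<bar>)\<^sup>2 + 2 * (\<theta>\<^sup>2 * D)\<^sup>2"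
    by (rule power2_sum_le)
  also have "(\<bar>\<theta>\<bar> * \<bar>?py\<bar>)\<^sup>2 = \<theta>\<^sup>2 * ?py\<^sup>2" by (simp add: power_mult_distrib)
  also have "(\<theta>\<^sup>2 * D)\<^sup>2 = \<theta> ^ 4 * D\<^sup>2" by (simp add: power_mult_distrib)
  also have "2 * (\<theta>\<^sup>2 * ?py\<^sup>2) + 2 * (\<theta> ^ 4 * D\<^sup>2) \<le> 2 * \<theta>\<^sup>2 * ?py\<^sup>2 + 24 * \<theta> ^ 4 * (1 + quartic x + quartic y)"
    using mult_left_mono[OF D2, of "\<theta> ^ 4"] by (simp add: algebra_simps)
  finally show ?thesis .
qed

text \<open>For fixed x the vector p is constant in y, so the second moment of its product with y is
  the squared norm of p, at most 16 in every dimension. As p disappears in the inner integral, no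
  measurable choice of p in x has to be made.\<close>

lemma increment_bound:
  fixes \<theta> :: real
  assumes \<theta>: "\<theta> \<noteq> 0" "\<bar>\<theta>\<bar> \<le> 1"
  shows "(\<integral>\<^sup>+x. \<integral>\<^sup>+y. ennreal ((max 0 (g (\<lambda>i\<in>I. cos \<theta> * x i + sin \<theta> * y i) - g x))\<^sup>2) \<partial>gauss I \<partial>gauss I)
    \<le> ennreal (32 * \<theta>\<^sup>2 + 24 * \<theta> ^ 4 * (1 + 2 * quartic_mean))"
proof -
  have inner: "(\<integral>\<^sup>+y. ennreal ((max 0 (g (\<lambda>i\<in>I. cos \<theta> * x i + sin \<theta> * y i) - g x))\<^sup>2) \<partial>gauss I)
    \<le> ennreal (32 * \<theta>\<^sup>2 + 24 * \<theta> ^ 4 * (1 + quartic x + quartic_mean))" for x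
  proof -
    \<comment> \<open>The slack is taken of the same order as the remainder; it is positive because
      \<theta> is nonzero.\<close>
    have "0 < \<theta>\<^sup>2" "\<theta>\<^sup>2 \<le> 2" using \<theta> by (auto simp: abs_square_le_1 intro: order_trans[of _ 1])
    then obtain p where p4: "L2_set p I \<le> 4"
      and p: "\<And>u. g (\<lambda>i. x i + u i) \<le> g x + \<theta>\<^sup>2 + (\<Sum>i\<in>I. p i * u i) + (L2_set u I)\<^sup>2"
      using moreau_supergradient[OF F] by metis
    have hb: "has_bochner_integral (gauss I) (\<lambda>y. 2 * \<theta>\<^sup>2 * (\<Sum>i\<in>I. p i * y i)\<^sup>2 + 24 * \<theta> ^ 4 * (1 + quartic x + quartic y))
      (2 * \<theta>\<^sup>2 * (\<Sum>i\<in>I. (p i)\<^sup>2) + 24 * \<theta> ^ 4 * (1 + quartic x + quartic_mean))"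
    proof (intro has_bochner_integral_add has_bochner_integral_mult_right has_bochner_integral_gauss_linear_sq I)
      show "has_bochner_integral (gauss I) (\<lambda>y. 1) (1 :: real)" "has_bochner_integral (gauss I) (\<lambda>y. quartic x) (quartic x)"
        by (simp_all add: has_bochner_integral_iff G.prob_space)
      show "has_bochner_integral (gauss I) quartic quartic_mean"
        by (simp add: has_bochner_integral_iff integrable_quartic quartic_mean_def)
    qed
    have "(\<integral>\<^sup>+y. ennreal ((max 0 (g (\<lambda>i\<in>I. cos \<theta> * x i + sin \<theta> * y i) - g x))\<^sup>2) \<partial>gauss I) \<le>
      (\<integral>\<^sup>+y. ennreal (2 * \<theta>\<^sup>2 * (\<Sum>i\<in>I. p i * y i)\<^sup>2 + 24 * \<theta> ^ 4 * (1 + quartic x + quartic y)) \<partial>gauss I)"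
      unfolding moreau_restrict by (intro nn_integral_mono ennreal_leI increment_pointwise \<theta> p4 p)
    also have "\<dots> = ennreal (2 * \<theta>\<^sup>2 * (\<Sum>i\<in>I. (p i)\<^sup>2) + 24 * \<theta> ^ 4 * (1 + quartic x + quartic_mean))"
      using hb by (subst nn_integral_eq_integral) (auto simp: has_bochner_integral_iff quartic_nonneg)
    also have "\<dots> \<le> ennreal (32 * \<theta>\<^sup>2 + 24 * \<theta> ^ 4 * (1 + quartic x + quartic_mean))"
    proof -
      have "(L2_set p I)\<^sup>2 \<le> 4\<^sup>2" by (intro power_mono p4) simp
      then have "(\<Sum>i\<in>I. (p i)\<^sup>2) \<le> 16" by (simp add: L2_set_power2)
      then have "2 * \<theta>\<^sup>2 * (\<Sum>i\<in>I. (p i)\<^sup>2) \<le> 2 * \<theta>\<^sup>2 * 16" by (intro mult_left_mono) auto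
      then show ?thesis by (intro ennreal_leI) simp
    qed
    finally show ?thesis .
  qed
  have "(\<integral>\<^sup>+x. \<integral>\<^sup>+y. ennreal ((max 0 (g (\<lambda>i\<in>I. cos \<theta> * x i + sin \<theta> * y i) - g x))\<^sup>2) \<partial>gauss I \<partial>gauss I)
    \<le> (\<integral>\<^sup>+x. ennreal (32 * \<theta>\<^sup>2 + 24 * \<theta> ^ 4 * (1 + quartic x + quartic_mean)) \<partial>gauss I)"
    by (intro nn_integral_mono inner)
  also have "\<dots> = ennreal (\<integral>x. 32 * \<theta>\<^sup>2 + 24 * \<theta> ^ 4 * (1 + quartic x + quartic_mean) \<partial>gauss I)"
    by (intro nn_integral_eq_integral) (auto simp: integrable_quartic quartic_nonneg quartic_mean_nonneg)
  also have "(\<integral>x. 32 * \<theta>\<^sup>2 + 24 * \<theta> ^ 4 * (1 + quartic x + quartic_mean) \<partial>gauss I) = 32 * \<theta>\<^sup>2 + 24 * \<theta> ^ 4 * (1 + 2 * quartic_mean)"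
    by (simp add: integrable_quartic G.prob_space quartic_mean_def[symmetric])
  finally show ?thesis .
qed

text \<open>Rotating the pair by \<phi> gives the point of the arc at angle \<phi> and its tangent
  direction, again two independent Gaussian vectors, so the step is distributed like one starting at
  angle 0. Negative \<theta> is allowed in order to run a step backwards.\<close>

lemma arc_increment_bound:
  fixes \<theta> \<phi> :: real
  assumes \<theta>: "\<theta> \<noteq> 0" "\<bar>\<theta>\<bar> \<le> 1" and \<phi>: "0 \<le> \<phi>" "\<phi> \<le> pi / 2"
  shows "(\<integral>\<^sup>+x. \<integral>\<^sup>+y. ennreal ((max 0 (g (\<lambda>i\<in>I. cos (\<phi> + \<theta>) * x i + sin (\<phi> + \<theta>) * y i) -
      g (\<lambda>i\<in>I. cos \<phi> * x i + sin \<phi> * y i)))\<^sup>2) \<partial>gauss I \<partial>gauss I)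
    \<le> ennreal (32 * \<theta>\<^sup>2 + 24 * \<theta> ^ 4 * (1 + 2 * quartic_mean))"
proof -
  let ?h = "\<lambda>x y. ennreal ((max 0 (g (\<lambda>i\<in>I. cos \<theta> * x i + sin \<theta> * y i) - g x))\<^sup>2)"
  have "cos \<phi> \<noteq> - 1" using \<phi> cos_ge_zero[of \<phi>] by auto
  moreover have "(cos \<phi>)\<^sup>2 + (sin \<phi>)\<^sup>2 = 1" by simp
  moreover have "case_prod ?h \<in> borel_measurable (PiM I (\<lambda>_. lborel) \<Otimes>\<^sub>M PiM I (\<lambda>_. lborel))" by measurable
  ultimately have "(\<integral>\<^sup>+x. \<integral>\<^sup>+y. ?h (\<lambda>i\<in>I. cos \<phi> * x i + sin \<phi> * y i) (\<lambda>i\<in>I. cos \<phi> * y i - sin \<phi> * x i) \<partial>gauss I \<partial>gauss I) =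
      (\<integral>\<^sup>+x. \<integral>\<^sup>+y. ?h x y \<partial>gauss I \<partial>gauss I)"
    by (intro nn_integral_gauss_rotate I)
  moreover have "(\<lambda>i\<in>I. cos \<theta> * (\<lambda>i\<in>I. cos \<phi> * x i + sin \<phi> * y i) i + sin \<theta> * (\<lambda>i\<in>I. cos \<phi> * y i - sin \<phi> * x i) i) =
      (\<lambda>i\<in>I. cos (\<phi> + \<theta>) * x i + sin (\<phi> + \<theta>) * y i)" for x y
    by (intro restrict_ext) (simp add: cos_add sin_add algebra_simps)
  ultimately show ?thesis using increment_bound[OF \<theta>] by simp
qed

text \<open>The quarter circle from x to y is cut into N steps of angle \<delta>. Cauchy-Schwarz
  costs a factor N and each of the N steps contributes at most 2 B, of order \<delta>^2, so N
  cancels. The leading part is 16 pi^2, and 165 leaves room for the remainder.\<close>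

lemma moreau_variance_bound:
  "(\<integral>\<^sup>+x. \<integral>\<^sup>+y. ennreal ((g x - g y)\<^sup>2) \<partial>gauss I \<partial>gauss I) \<le> 165"
proof -
  \<comment> \<open>N is so large that the quartic remainder contributes at most 2 to the factor 66
    in the last estimate; N \<ge> 2 ensures \<delta> \<le> 1.\<close>
  obtain N :: nat where N: "2 \<le> N" "96 * (1 + 2 * quartic_mean) \<le> real N"
    using real_arch_simple[of "max 2 (96 * (1 + 2 * quartic_mean))"] by auto
  define \<delta> where "\<delta> = pi / (2 * N)"
  define B where "B = 32 * \<delta>\<^sup>2 + 24 * \<delta> ^ 4 * (1 + 2 * quartic_mean)"
  have N\<delta>: "N * \<delta> = pi / 2" using N by (simp add: \<delta>_def)
  have \<delta>1: "\<delta> \<le> 2 / N" using N pi_less_4 by (simp add: \<delta>_def field_simps)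
  also have "\<dots> \<le> 1" using N by simp
  finally have \<delta>: "0 < \<delta>" "\<delta> \<le> 1" using N by (auto simp: \<delta>_def)
  define z where "z k x y = (\<lambda>i\<in>I. cos (k * \<delta>) * x i + sin (k * \<delta>) * y i)" for k :: nat and x y :: "'i \<Rightarrow> real"
  have z0: "g (z 0 x y) = g x" for x y by (simp add: z_def moreau_restrict)
  have zN: "g (z N x y) = g y" for x y by (simp add: z_def N\<delta> moreau_restrict)
  \<comment> \<open>Telescoping and Cauchy-Schwarz. Each squared increment is split into its
    positive and negative parts, to which the one-sided estimate applies separately.\<close>
  have pointwise: "ennreal ((g x - g y)\<^sup>2) \<le> ennreal N * (\<Sum>k<N.
      ennreal ((max 0 (g (z (Suc k) x y) - g (z k x y)))\<^sup>2) + ennreal ((max 0 (g (z k x y) - g (z (Suc k) x y)))\<^sup>2))" for x y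
  proof -
    have "(\<Sum>k<N. g (z (Suc k) x y) - g (z k x y)) = g y - g x"
      by (subst sum_lessThan_telescope) (simp add: z0 zN)
    then have "(g x - g y)\<^sup>2 = (\<Sum>k<N. g (z (Suc k) x y) - g (z k x y))\<^sup>2"
      by (simp add: power2_commute)
    also have "\<dots> \<le> (\<Sum>k<N. (g (z (Suc k) x y) - g (z k x y))\<^sup>2) * card {..<N}"
      by (rule sum_squared_le_sum_of_squares)
    also have "(\<Sum>k<N. (g (z (Suc k) x y) - g (z k x y))\<^sup>2) = (\<Sum>k<N.
      (max 0 (g (z (Suc k) x y) - g (z k x y)))\<^sup>2 + (max 0 (g (z k x y) - g (z (Suc k) x y)))\<^sup>2)"
      by (intro sum.cong refl) (auto simp: max_def power2_commute)
    finally have "ennreal ((g x - g y)\<^sup>2) \<le> ennreal (N * (\<Sum>k<N.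
      (max 0 (g (z (Suc k) x y) - g (z k x y)))\<^sup>2 + (max 0 (g (z k x y) - g (z (Suc k) x y)))\<^sup>2))"
      by (intro ennreal_leI) (simp add: mult.commute)
    then show ?thesis by (simp add: ennreal_mult sum_nonneg flip: sum_ennreal ennreal_plus)
  qed
  define P where "P k x y = ennreal ((max 0 (g (z (Suc k) x y) - g (z k x y)))\<^sup>2)" for k and x y :: "'i \<Rightarrow> real"
  define M where "M k x y = ennreal ((max 0 (g (z k x y) - g (z (Suc k) x y)))\<^sup>2)" for k and x y :: "'i \<Rightarrow> real"
  have [measurable]: "case_prod (P k) \<in> borel_measurable (PiM I (\<lambda>_. lborel) \<Otimes>\<^sub>M PiM I (\<lambda>_. lborel))"
      "case_prod (M k) \<in> borel_measurable (PiM I (\<lambda>_. lborel) \<Otimes>\<^sub>M PiM I (\<lambda>_. lborel))" for k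
    unfolding P_def M_def z_def by measurable
  have up: "(\<integral>\<^sup>+x. \<integral>\<^sup>+y. P k x y \<partial>gauss I \<partial>gauss I) \<le> ennreal B"
    if "k < N" for k
  proof -
    have "k * \<delta> \<le> N * \<delta>" using that \<delta> by (intro mult_right_mono) auto
    moreover have "k * \<delta> + \<delta> = Suc k * \<delta>" by (simp add: algebra_simps)
    ultimately show ?thesis
      using arc_increment_bound[of \<delta> "k * \<delta>"] \<delta> unfolding N\<delta> z_def B_def P_def by simp
  qed
  \<comment> \<open>A decrease over a step is an increase over the same step run backwards from its
    other endpoint, with angle - \<delta>.\<close>
  have down: "(\<integral>\<^sup>+x. \<integral>\<^sup>+y. M k x y \<partial>gauss I \<partial>gauss I) \<le> ennreal B"
    if "k < N" for k
  proof -
    have "Suc k * \<delta> \<le> N * \<delta>" using that \<delta> by (intro mult_right_mono) auto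
    moreover have "Suc k * \<delta> + - \<delta> = k * \<delta>" by (simp add: algebra_simps)
    ultimately show ?thesis
      using arc_increment_bound[of "- \<delta>" "Suc k * \<delta>"] \<delta> unfolding N\<delta> z_def B_def M_def by simp
  qed
  have "(\<integral>\<^sup>+x. \<integral>\<^sup>+y. ennreal ((g x - g y)\<^sup>2) \<partial>gauss I \<partial>gauss I) \<le>
      (\<integral>\<^sup>+x. \<integral>\<^sup>+y. ennreal N * (\<Sum>k<N. P k x y + M k x y) \<partial>gauss I \<partial>gauss I)"
    unfolding P_def M_def by (intro nn_integral_mono pointwise)
  also have "\<dots> = (\<integral>\<^sup>+x. ennreal N * (\<Sum>k<N. (\<integral>\<^sup>+y. P k x y \<partial>gauss I) + (\<integral>\<^sup>+y. M k x y \<partial>gauss I)) \<partial>gauss I)"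
  proof (intro nn_integral_cong)
    fix x assume "x \<in> space (gauss I)"
    then have [measurable]: "x \<in> space (PiM I (\<lambda>_. lborel))" by (simp add: space_PiM)
    show "(\<integral>\<^sup>+y. ennreal N * (\<Sum>k<N. P k x y + M k x y) \<partial>gauss I) =
        ennreal N * (\<Sum>k<N. (\<integral>\<^sup>+y. P k x y \<partial>gauss I) + (\<integral>\<^sup>+y. M k x y \<partial>gauss I))"
      by (simp add: nn_integral_cmult nn_integral_sum nn_integral_add)
  qed
  also have "\<dots> = ennreal N * (\<Sum>k<N. (\<integral>\<^sup>+x. \<integral>\<^sup>+y. P k x y \<partial>gauss I \<partial>gauss I)
      + (\<integral>\<^sup>+x. \<integral>\<^sup>+y. M k x y \<partial>gauss I \<partial>gauss I))"
    by (simp add: nn_integral_cmult nn_integral_sum nn_integral_add)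
  also have "\<dots> \<le> ennreal N * (\<Sum>k<N. ennreal B + ennreal B)"
    by (intro mult_left_mono sum_mono add_mono up down) auto
  also have "\<dots> = ennreal (N * (N * (2 * B)))"
  proof -
    have "0 \<le> B" using quartic_mean_nonneg by (simp add: B_def)
    then have "ennreal B + ennreal B = ennreal (2 * B)" by (subst ennreal_plus[symmetric]) simp_all
    then show ?thesis using \<open>0 \<le> B\<close> by (simp add: ennreal_mult ennreal_of_nat_eq_real_of_nat)
  qed
  also have "\<dots> \<le> ennreal 165"
  proof (rule ennreal_leI)
    \<comment> \<open>Since N \<delta> = pi / 2, grouping by this product leaves a leading constant
      free of N and of the dimension.\<close>
    have "N * (N * (2 * B)) = (N * \<delta>)\<^sup>2 * (64 + 48 * \<delta>\<^sup>2 * (1 + 2 * quartic_mean))"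
      by (simp add: B_def power2_eq_square power4_eq_xxxx algebra_simps)
    also have "(N * \<delta>)\<^sup>2 = pi\<^sup>2 / 4" by (simp add: N\<delta> power_divide)
    also have "48 * \<delta>\<^sup>2 * (1 + 2 * quartic_mean) \<le> 2"
    proof -
      have "\<delta>\<^sup>2 \<le> \<delta> * 1" unfolding power2_eq_square using \<delta> by (intro mult_left_mono) auto
      also have "\<dots> \<le> 2 / N" using \<delta>1 by simp
      finally have "48 * \<delta>\<^sup>2 * (1 + 2 * quartic_mean) \<le> 48 * (2 / N) * (1 + 2 * quartic_mean)"
        using quartic_mean_nonneg by (intro mult_right_mono) auto
      also have "\<dots> \<le> 2" using N by (simp add: field_simps)
      finally show ?thesis .
    qed
    also have "pi\<^sup>2 / 4 * (64 + 2) \<le> 165"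
    proof -
      have "pi\<^sup>2 \<le> 3.15\<^sup>2" using pi_approx by (intro power_mono) auto
      then show ?thesis by (simp add: power2_eq_square)
    qed
    finally show "N * (N * (2 * B)) \<le> 165" by (simp add: mult_left_mono)
  qed
  finally show ?thesis by simp
qed

text \<open>The envelope is uniformly close to F, and \<bar>d\<bar> \<le> d^2 + 1 turns the
  second-moment bound into a first-moment one. The resulting 167 is rounded up to 200.\<close>

theorem gauss_concentration:
  "(\<integral>\<^sup>+x. \<integral>\<^sup>+y. ennreal \<bar>F x - F y\<bar> \<partial>gauss I \<partial>gauss I) \<le> 200"
proof -
  have "\<bar>F x - F y\<bar> \<le> (g x - g y)\<^sup>2 + 2" for x y
  proof -
    have "\<bar>F x - F y\<bar> \<le> \<bar>g x - g y\<bar> + 1"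
      using moreau_ge[OF F, of x] moreau_ge[OF F, of y] moreau_le_self[OF F, of x] moreau_le_self[OF F, of y] by linarith
    moreover have "\<bar>d\<bar> \<le> d\<^sup>2 + 1" for d :: real
      using zero_le_power2[of "\<bar>d\<bar> - 1 / 2"] by (simp add: power2_diff power_divide)
    from this[of "g x - g y"] have "\<bar>g x - g y\<bar> \<le> (g x - g y)\<^sup>2 + 1" .
    ultimately show ?thesis by linarith
  qed
  then have "(\<integral>\<^sup>+x. \<integral>\<^sup>+y. ennreal \<bar>F x - F y\<bar> \<partial>gauss I \<partial>gauss I) \<le>
      (\<integral>\<^sup>+x. \<integral>\<^sup>+y. ennreal ((g x - g y)\<^sup>2) + 2 \<partial>gauss I \<partial>gauss I)"
    by (intro nn_integral_mono) (simp add: flip: ennreal_plus ennreal_numeral)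
  also have "\<dots> = (\<integral>\<^sup>+x. (\<integral>\<^sup>+y. ennreal ((g x - g y)\<^sup>2) \<partial>gauss I) + 2 \<partial>gauss I)"
    by (intro nn_integral_cong) (simp add: nn_integral_add G.emeasure_space_1)
  also have "\<dots> = (\<integral>\<^sup>+x. \<integral>\<^sup>+y. ennreal ((g x - g y)\<^sup>2) \<partial>gauss I \<partial>gauss I) + 2"
    by (simp add: nn_integral_add G.emeasure_space_1)
  also have "\<dots> \<le> 165 + 2" by (intro add_mono moreau_variance_bound) auto
  also have "\<dots> \<le> 200" by simp
  finally show ?thesis .
qed

end

section \<open>The Gaussian scale mixture\<close>

text \<open>The substitution u = A / (2 t^2) turns this into the Gamma integral at p / 2. With A = 1
  it normalises the half-line law; with A equal to one plus a squared norm it produces the density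
  on the n-dimensional space.\<close>

lemma nn_integral_inverse_square_Gamma:
  fixes A p :: real
  assumes A: "0 < A" and p: "0 < p"
  shows "(\<integral>\<^sup>+t. ennreal (indicator {0<..} t * ((1 / t powr (p + 1)) * exp (- (A / (2 * t\<^sup>2))))) \<partial>lborel)
    = ennreal (2 powr (p / 2 - 1) * Gamma (p / 2) / A powr (p / 2))"
proof -
  define g where "g t = A / (2 * t\<^sup>2)" for t :: real
  define f where "f u = u powr (p / 2 - 1) / exp u" for u :: real
  \<comment> \<open>The constant left by the substitution: the Jacobian times \<open>f (g t)\<close>
    is c times the desired integrand.\<close>
  define c where "c = A * (A / 2) powr (p / 2 - 1)"
  have c: "c = A powr (p / 2) / 2 powr (p / 2 - 1)"
    using A powr_mult_base[of A "p / 2 - 1"] by (simp add: c_def powr_divide)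
  have "(f has_integral Gamma (p / 2)) {0<..}"
  proof -
    have "(f has_integral Gamma (p / 2)) {0..}"
      unfolding f_def using p by (intro Gamma_integral_real) simp
    moreover have "negligible {x \<in> {0..} - {0<..}. f x \<noteq> 0}" "negligible {x \<in> {0<..} - {0..}. f x \<noteq> 0}"
      by (rule negligible_subset[of "{0}"]; auto)+
    ultimately show ?thesis by (simp only: has_integral_spike_set_eq[of "{0..}" "{0<..}" f])
  qed
  moreover have "f absolutely_integrable_on {0<..}"
    using calculation by (intro nonnegative_absolutely_integrable_1) (auto simp: f_def integrable_on_def)
  moreover have im: "g ` {0<..} = {0<..}"
  proof
    show "g ` {0<..} \<subseteq> {0<..}" using A by (auto simp: g_def)
    show "{0<..} \<subseteq> g ` {0<..}"
    proof
      fix u :: real assume u: "u \<in> {0<..}"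
      then have "u = g (sqrt (A / (2 * u)))" "sqrt (A / (2 * u)) \<in> {0<..}" using A by (auto simp: g_def)
      then show "u \<in> g ` {0<..}" by (rule image_eqI)
    qed
  qed
  moreover have "inj_on g {0<..}"
    using A by (auto simp: inj_on_def g_def field_simps power2_eq_iff)
  moreover have "(g has_field_derivative - (A / t ^ 3)) (at t within {0<..})" if "t \<in> {0<..}" for t
    unfolding g_def using that
    by (auto intro!: derivative_eq_intros simp: field_simps power2_eq_square power3_eq_cube)
  ultimately have "(\<lambda>t. \<bar>- (A / t ^ 3)\<bar> * f (g t)) absolutely_integrable_on {0<..} \<and>
      integral {0<..} (\<lambda>t. \<bar>- (A / t ^ 3)\<bar> * f (g t)) = Gamma (p / 2)"
    using has_absolute_integral_change_of_variables_1'[of "{0<..}" g "\<lambda>t. - (A / t ^ 3)" f "Gamma (p / 2)"]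
    by (auto simp: integral_unique)
  then have "((\<lambda>t. \<bar>- (A / t ^ 3)\<bar> * f (g t)) has_integral Gamma (p / 2)) {0<..}"
    using absolutely_integrable_on_def has_integral_iff by blast
  then have 1: "((\<lambda>t. (\<bar>- (A / t ^ 3)\<bar> * f (g t)) * (1 / c)) has_integral Gamma (p / 2) * (1 / c)) {0<..}"
    by (rule has_integral_mult_left)
  have 2: "(\<bar>- (A / t ^ 3)\<bar> * f (g t)) * (1 / c) = (1 / t powr (p + 1)) * exp (- (A / (2 * t\<^sup>2)))"
    if "t \<in> {0<..}" for t
  proof -
    from that have t: "t > 0" by simp
    have E1: "(A / (2 * t\<^sup>2)) powr (p / 2 - 1) = (A / 2) powr (p / 2 - 1) / (t powr (p - 2))"
    proof -
      have "(t\<^sup>2) powr (p / 2 - 1) = t powr (p - 2)"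
      proof -
        have "t\<^sup>2 = t powr 2" using t by simp
        then have "(t\<^sup>2) powr (p / 2 - 1) = t powr (2 * (p / 2 - 1))" by (simp only: powr_powr)
        then show ?thesis by (simp add: algebra_simps)
      qed
      then show ?thesis using t A by (simp add: powr_divide powr_mult)
    qed
    have E2: "t ^ 3 * t powr (p - 2) = t powr (p + 1)"
    proof -
      have "t ^ 3 = t powr 3" using t by simp
      then have "t ^ 3 * t powr (p - 2) = t powr (3 + (p - 2))" by (simp only: powr_add)
      then show ?thesis by (simp add: algebra_simps)
    qed
    have "\<bar>- (A / t ^ 3)\<bar> = A / t ^ 3" using t A by simp
    moreover have "(A / 2) powr (p / 2 - 1) \<noteq> 0" using A by simp
    then have "(A / t ^ 3) * (((A / 2) powr (p / 2 - 1) / t powr (p - 2)) / q) * (1 / (A * (A / 2) powr (p / 2 - 1)))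
        = 1 / (t ^ 3 * t powr (p - 2)) * (1 / q)" for q
      using A by simp
    ultimately show ?thesis unfolding f_def g_def c_def E1 E2 by (simp add: exp_minus inverse_eq_divide)
  qed
  have 3: "Gamma (p / 2) * (1 / c) = 2 powr (p / 2 - 1) * Gamma (p / 2) / A powr (p / 2)"
    by (simp add: c)
  have "((\<lambda>t. (1 / t powr (p + 1)) * exp (- (A / (2 * t\<^sup>2)))) has_integral
      (2 powr (p / 2 - 1) * Gamma (p / 2) / A powr (p / 2))) {0<..}"
    unfolding 3[symmetric] by (rule has_integral_eq[OF 2 1])
  from nn_integral_has_integral_lebesgue[OF _ this] show ?thesis by simp
qed

section \<open>The law of the scale on the half-line\<close>

lemma sets_nu_half_line [measurable_cong, simp]: "sets (nu_half_line \<beta>) = sets (restrict_space borel {0..})"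
  by (simp add: nu_half_line_def cong: sets_restrict_space_cong)

lemma space_nu_half_line [simp]: "space (nu_half_line \<beta>) = {0..}"
  by (simp add: nu_half_line_def space_restrict_space)

lemma measurable_nu_half_line [measurable (raw)]:
  "f \<in> borel_measurable borel \<Longrightarrow> f \<in> borel_measurable (nu_half_line \<beta>)"
  by (simp cong: measurable_cong_sets add: measurable_restrict_space1)

lemma nn_integral_nu_half_line:
  assumes "\<beta> > 0" and [measurable]: "h \<in> borel_measurable borel"
  shows "(\<integral>\<^sup>+t. h t \<partial>nu_half_line \<beta>) = (\<integral>\<^sup>+t. ennreal (2 powr (1 - \<beta> / 2) / Gamma (\<beta> / 2) *
      (indicator {0<..} t * ((1 / t powr (\<beta> + 1)) * exp (- (1 / (2 * t\<^sup>2)))))) * h t \<partial>lborel)"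
proof -
  have "(\<integral>\<^sup>+t. h t \<partial>nu_half_line \<beta>) = (\<integral>\<^sup>+t. ennreal (2 powr (1 - \<beta> / 2) / Gamma (\<beta> / 2) * (1 / t powr (\<beta> + 1)) *
      exp (- (1 / (2 * t\<^sup>2)))) * h t \<partial>restrict_space lborel {0..})"
    unfolding nu_half_line_def by (intro nn_integral_density measurable_restrict_space1) auto
  also have "\<dots> = (\<integral>\<^sup>+t. ennreal (2 powr (1 - \<beta> / 2) / Gamma (\<beta> / 2) * (1 / t powr (\<beta> + 1)) *
      exp (- (1 / (2 * t\<^sup>2)))) * h t * indicator {0..} t \<partial>lborel)"
    by (subst nn_integral_restrict_space) auto
  \<comment> \<open>At t = 0 the factor \<open>1 / t powr (\<beta> + 1)\<close> is 1 / 0, which is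
    0, so the closed and the open half-line give the same integrand.\<close>
  also have "\<dots> = (\<integral>\<^sup>+t. ennreal (2 powr (1 - \<beta> / 2) / Gamma (\<beta> / 2) *
      (indicator {0<..} t * ((1 / t powr (\<beta> + 1)) * exp (- (1 / (2 * t\<^sup>2)))))) * h t \<partial>lborel)"
    by (intro nn_integral_cong) (auto simp: indicator_def mult.assoc)
  finally show ?thesis .
qed

lemma prob_space_nu_half_line:
  assumes \<beta>: "\<beta> > 0"
  shows "prob_space (nu_half_line \<beta>)"
proof
  have "emeasure (nu_half_line \<beta>) (space (nu_half_line \<beta>)) = (\<integral>\<^sup>+t. 1 \<partial>nu_half_line \<beta>)"
    by simp
  also have "\<dots> = (\<integral>\<^sup>+t. ennreal (2 powr (1 - \<beta> / 2) / Gamma (\<beta> / 2)) *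
      ennreal (indicator {0<..} t * ((1 / t powr (\<beta> + 1)) * exp (- (1 / (2 * t\<^sup>2))))) \<partial>lborel)"
    using \<beta> Gamma_real_pos[of "\<beta> / 2"]
    by (subst nn_integral_nu_half_line) (auto simp: ennreal_mult[symmetric])
  also have "\<dots> = ennreal (2 powr (1 - \<beta> / 2) / Gamma (\<beta> / 2)) * ennreal (2 powr (\<beta> / 2 - 1) * Gamma (\<beta> / 2) / 1 powr (\<beta> / 2))"
    by (subst nn_integral_cmult, measurable, subst nn_integral_inverse_square_Gamma) (use \<beta> in auto)
  also have "\<dots> = ennreal (2 powr (1 - \<beta> / 2) * 2 powr (\<beta> / 2 - 1))"
    using \<beta> less_imp_neq[OF Gamma_real_pos[of "\<beta> / 2"]] by (subst ennreal_mult[symmetric]) auto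
  also have "\<dots> = 1" by (simp add: powr_add[symmetric])
  finally show "emeasure (nu_half_line \<beta>) (space (nu_half_line \<beta>)) = 1" .
qed

section \<open>Scaled Gaussian vectors and the mixture representation\<close>

lemma distr_std_normal_scale:
  assumes t: "t > 0"
  shows "distr std_normal_distribution lborel (\<lambda>x. t * x) = density lborel (normal_density 0 t)"
proof (rule measure_eqI)
  fix A assume "A \<in> sets (distr std_normal_distribution lborel (\<lambda>x. t * x))"
  then have [measurable]: "A \<in> sets borel" by simp
  have nd: "t * normal_density 0 t (t * x) = std_normal_density x" for x
    using t by (simp add: normal_density_def real_sqrt_mult power_mult_distrib)
  have "emeasure (density lborel (normal_density 0 t)) A = (\<integral>\<^sup>+x. ennreal (normal_density 0 t x) * indicator A x \<partial>lborel)"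
    by (simp add: emeasure_density)
  also have "\<dots> = ennreal \<bar>t\<bar> * (\<integral>\<^sup>+x. ennreal (normal_density 0 t (0 + t * x)) * indicator A (0 + t * x) \<partial>lborel)"
    using t by (intro nn_integral_real_affine) auto
  also have "\<dots> = (\<integral>\<^sup>+x. ennreal \<bar>t\<bar> * (ennreal (normal_density 0 t (0 + t * x)) * indicator A (0 + t * x)) \<partial>lborel)"
    by (intro nn_integral_cmult[symmetric]) measurable
  also have "\<dots> = (\<integral>\<^sup>+x. ennreal (std_normal_density x) * indicator A (t * x) \<partial>lborel)"
    using t by (intro nn_integral_cong) (simp add: mult.assoc[symmetric] ennreal_mult[symmetric] nd)
  also have "\<dots> = (\<integral>\<^sup>+x. indicator A (t * x) \<partial>std_normal_distribution)"
    by (subst nn_integral_density) auto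
  also have "\<dots> = emeasure (distr std_normal_distribution lborel (\<lambda>x. t * x)) A"
    by (subst nn_integral_distr[symmetric, where f="indicator A" and M=std_normal_distribution and M'=lborel]) auto
  finally show "emeasure (distr std_normal_distribution lborel (\<lambda>x. t * x)) A = emeasure (density lborel (normal_density 0 t)) A"
    by simp
qed simp

lemma nn_integral_gauss_scale:
  fixes I :: "'i set"
  assumes I: "finite I" and t: "t > 0" and h[measurable]: "h \<in> borel_measurable (PiM I (\<lambda>_. lborel))"
  shows "(\<integral>\<^sup>+z. h (\<lambda>i\<in>I. t * z i) \<partial>gauss I) =
    (\<integral>\<^sup>+x. ennreal ((1 / sqrt (2 * pi)) ^ card I * (1 / t) ^ card I * exp (- (L2_set x I)\<^sup>2 / (2 * t\<^sup>2))) * h x \<partial>PiM I (\<lambda>_. lborel))"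
proof -
  have "(\<integral>\<^sup>+z. h (\<lambda>i\<in>I. t * z i) \<partial>gauss I) = (\<integral>\<^sup>+x. h x \<partial>distr (gauss I) (PiM I (\<lambda>_. lborel)) (\<lambda>z. \<lambda>i\<in>I. t * z i))"
    by (intro nn_integral_distr[symmetric]) measurable
  also have "distr (gauss I) (PiM I (\<lambda>_. lborel)) (\<lambda>z. \<lambda>i\<in>I. t * z i) = PiM I (\<lambda>_. density lborel (normal_density 0 t))"
    unfolding distr_std_normal_scale[OF t, symmetric]
    by (rule PiM_distr[OF I])
      (auto simp: distr_std_normal_scale[OF t] t intro!: prob_space_imp_sigma_finite prob_space_normal_density)
  also have "\<dots> = density (PiM I (\<lambda>_. lborel)) (\<lambda>x. \<Prod>i\<in>I. ennreal (normal_density 0 t (x i)))"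
    by (rule PiM_density[OF I])
      (auto simp: t sigma_finite_lborel intro!: prob_space_imp_sigma_finite prob_space_normal_density)
  also have "(\<lambda>x. \<Prod>i\<in>I. ennreal (normal_density 0 t (x i))) = (\<lambda>x.
      ennreal ((1 / sqrt (2 * pi)) ^ card I * (1 / t) ^ card I * exp (- (L2_set x I)\<^sup>2 / (2 * t\<^sup>2))))"
  proof
    fix x :: "'i \<Rightarrow> real"
    have "(\<Prod>i\<in>I. normal_density 0 t (x i)) = (\<Prod>i\<in>I. (1 / sqrt (2 * pi)) * (1 / t) * exp (- (x i)\<^sup>2 / (2 * t\<^sup>2)))"
      using t by (intro prod.cong) (auto simp: normal_density_def real_sqrt_mult)
    also have "\<dots> = (1 / sqrt (2 * pi)) ^ card I * (1 / t) ^ card I * exp (\<Sum>i\<in>I. - (x i)\<^sup>2 / (2 * t\<^sup>2))"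
      unfolding prod.distrib by (simp add: I exp_sum)
    also have "(\<Sum>i\<in>I. - (x i)\<^sup>2 / (2 * t\<^sup>2)) = - (L2_set x I)\<^sup>2 / (2 * t\<^sup>2)"
      by (simp add: L2_set_def sum_nonneg sum_negf sum_divide_distrib)
    finally show "(\<Prod>i\<in>I. ennreal (normal_density 0 t (x i))) =
      ennreal ((1 / sqrt (2 * pi)) ^ card I * (1 / t) ^ card I * exp (- (L2_set x I)\<^sup>2 / (2 * t\<^sup>2)))"
      by (subst prod_ennreal) auto
  qed
  finally show ?thesis
    by (subst (asm) nn_integral_density) (auto simp: L2_set_def)
qed

lemma measurable_scale_mixture [measurable]:
  "(\<lambda>(t, z). \<lambda>i\<in>I. t * z i) \<in> measurable (nu_half_line \<beta> \<Otimes>\<^sub>M gauss I) (PiM I (\<lambda>_. lborel))"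
proof -
  have [measurable]: "(\<lambda>x. fst x) \<in> borel_measurable (nu_half_line \<beta> \<Otimes>\<^sub>M gauss I)"
    by (rule measurable_compose[OF measurable_fst]) measurable
  show ?thesis unfolding case_prod_beta by measurable
qed

text \<open>By Tonelli the mixture has as density at x the average over t of the normal density of
  deviation t. The two exponentials merge with A equal to one plus the squared norm of x, the powers
  of t merge to n + \<beta> + 1, and the inverse-square Gamma integral gives the stated
  density.\<close>

theorem nu_Rn_eq_mixture:
  assumes \<beta>: "\<beta> > 0"
  shows "nu_Rn n \<beta> = distr (nu_half_line \<beta> \<Otimes>\<^sub>M gauss {..<n}) (lebesgue_Rn n) (\<lambda>(t, z). \<lambda>i\<in>{..<n}. t * z i)"
proof (rule measure_eqI)
  show "sets (nu_Rn n \<beta>) = sets (distr (nu_half_line \<beta> \<Otimes>\<^sub>M gauss {..<n}) (lebesgue_Rn n) (\<lambda>(t, z). \<lambda>i\<in>{..<n}. t * z i))"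
    by (simp add: nu_Rn_def)
  fix S assume "S \<in> sets (nu_Rn n \<beta>)"
  define I where "I = {..<n}"
  have I: "finite I" "card I = n" by (auto simp: I_def)
  let ?L = "PiM I (\<lambda>_. lborel :: real measure)"
  have L: "lebesgue_Rn n = ?L" by (simp add: lebesgue_Rn_def I_def)
  from \<open>S \<in> _\<close> have S[measurable]: "S \<in> sets ?L" by (simp add: nu_Rn_def L)
  interpret product_sigma_finite "\<lambda>_::nat. lborel :: real measure"
    by (simp add: product_sigma_finite_def sigma_finite_lborel)
  interpret L: sigma_finite_measure ?L by (rule sigma_finite[OF I(1)])
  interpret P: pair_sigma_finite lborel ?L ..
  interpret G: prob_space "gauss I" by (rule prob_space_gauss)
  have Gp: "Gamma (\<beta> / 2) > 0" "Gamma ((real n + \<beta>) / 2) > 0" using \<beta> by (auto intro!: Gamma_real_pos)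
  \<comment> \<open>The indicator makes d vanish for t \<le> 0, where the scaled vector has no
    density, so the integral over t can run over the whole line.\<close>
  define d where "d t = 2 powr (1 - \<beta> / 2) / Gamma (\<beta> / 2) *
      (indicator {0<..} t * ((1 / t powr (\<beta> + 1)) * exp (- (1 / (2 * t\<^sup>2)))))" for t :: real
  have d0: "0 \<le> d t" for t using Gp by (simp add: d_def)
  have [measurable]: "d \<in> borel_measurable borel" unfolding d_def[abs_def] by measurable
  define k where "k t x = (1 / sqrt (2 * pi)) ^ n * (1 / t) ^ n * exp (- (L2_set x I)\<^sup>2 / (2 * t\<^sup>2))"
    for t :: real and x :: "nat \<Rightarrow> real"
  have [measurable]: "case_prod k \<in> borel_measurable (lborel \<Otimes>\<^sub>M ?L)"
    unfolding k_def L2_set_def by measurable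
  define h where "h t = (\<integral>\<^sup>+z. indicator S (\<lambda>i\<in>I. t * z i) \<partial>gauss I)" for t :: real
  have h[measurable]: "h \<in> borel_measurable borel"
    unfolding h_def by measurable
  have "emeasure (distr (nu_half_line \<beta> \<Otimes>\<^sub>M gauss I) ?L (\<lambda>(t, z). \<lambda>i\<in>I. t * z i)) S =
      (\<integral>\<^sup>+x. indicator S x \<partial>distr (nu_half_line \<beta> \<Otimes>\<^sub>M gauss I) ?L (\<lambda>(t, z). \<lambda>i\<in>I. t * z i))"
    by simp
  also have "\<dots> = (\<integral>\<^sup>+p. indicator S (\<lambda>i\<in>I. fst p * snd p i) \<partial>(nu_half_line \<beta> \<Otimes>\<^sub>M gauss I))"
    by (subst nn_integral_distr) (auto simp: case_prod_beta)
  also have "\<dots> = (\<integral>\<^sup>+t. h t \<partial>nu_half_line \<beta>)"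
  proof -
    have [measurable]: "(\<lambda>p. \<lambda>i\<in>I. fst p * snd p i) \<in> measurable (nu_half_line \<beta> \<Otimes>\<^sub>M gauss I) ?L"
      using measurable_scale_mixture[of I \<beta>] by (simp add: case_prod_beta)
    show ?thesis
      unfolding h_def by (subst G.nn_integral_fst[symmetric]) auto
  qed
  also have "\<dots> = (\<integral>\<^sup>+t. ennreal (d t) * h t \<partial>lborel)"
    unfolding d_def by (rule nn_integral_nu_half_line[OF \<beta> h])
  also have "\<dots> = (\<integral>\<^sup>+t. \<integral>\<^sup>+x. ennreal (d t) * (ennreal (k t x) * indicator S x) \<partial>?L \<partial>lborel)"
  proof (rule nn_integral_cong)
    fix t :: real
    show "ennreal (d t) * h t = (\<integral>\<^sup>+x. ennreal (d t) * (ennreal (k t x) * indicator S x) \<partial>?L)"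
    proof (cases "t > 0")
      case True
      have "h t = (\<integral>\<^sup>+x. ennreal (k t x) * indicator S x \<partial>?L)"
        unfolding h_def k_def by (subst nn_integral_gauss_scale[OF I(1) True]) (auto simp: I)
      then show ?thesis by (simp add: nn_integral_cmult)
    qed (simp add: d_def)
  qed
  also have "\<dots> = (\<integral>\<^sup>+x. \<integral>\<^sup>+t. ennreal (d t) * (ennreal (k t x) * indicator S x) \<partial>lborel \<partial>?L)"
    by (rule P.Fubini'[symmetric]) measurable
  also have "\<dots> = (\<integral>\<^sup>+x. ennreal (
     Gamma ((real n + \<beta>) / 2) / (pi powr (real n / 2) * Gamma (\<beta> / 2)) *
     (1 / (1 + (L2_set x I)\<^sup>2) powr ((real n + \<beta>) / 2))) * indicator S x \<partial>?L)"
  proof (rule nn_integral_cong)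
    fix x :: "nat \<Rightarrow> real"
    define A where "A = 1 + (L2_set x I)\<^sup>2"
    have A: "A > 0" unfolding A_def by (simp add: add_pos_nonneg)
    define C where "C = 2 powr (1 - \<beta> / 2) / Gamma (\<beta> / 2) * (1 / sqrt (2 * pi)) ^ n"
    have C0: "0 \<le> C" using Gp by (simp add: C_def)
    have dk: "d t * k t x = C * (indicator {0<..} t * ((1 / t powr ((n + \<beta>) + 1)) * exp (- (A / (2 * t\<^sup>2)))))" for t
    proof (cases "t > 0")
      case True
      have "t powr (n + \<beta> + 1) = t ^ n * t powr (\<beta> + 1)"
        using True by (simp add: powr_realpow[symmetric] powr_add[symmetric] add.assoc)
      moreover have "exp (- (A / (2 * t\<^sup>2))) = exp (- (1 / (2 * t\<^sup>2))) * exp (- (L2_set x I)\<^sup>2 / (2 * t\<^sup>2))"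
        by (simp add: A_def exp_add[symmetric] add_divide_distrib)
      ultimately show ?thesis using True by (simp add: d_def k_def C_def power_one_over mult.commute mult.left_commute)
    qed (simp add: d_def)
    have "(\<integral>\<^sup>+t. ennreal (d t) * (ennreal (k t x) * indicator S x) \<partial>lborel) =
        (\<integral>\<^sup>+t. ennreal C * ennreal (indicator {0<..} t * ((1 / t powr ((n + \<beta>) + 1)) * exp (- (A / (2 * t\<^sup>2))))) * indicator S x \<partial>lborel)"
      by (intro nn_integral_cong)
        (simp add: mult.assoc[symmetric] ennreal_mult'[symmetric] ennreal_mult''[symmetric] d0 C0 dk)
    also have "\<dots> = ennreal C * ennreal (2 powr ((n + \<beta>) / 2 - 1) * Gamma ((n + \<beta>) / 2) / A powr ((n + \<beta>) / 2)) * indicator S x"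
      by (subst nn_integral_multc, measurable, subst nn_integral_cmult, measurable,
          subst nn_integral_inverse_square_Gamma) (use \<beta> A in auto)
    also have "ennreal C * ennreal (2 powr ((n + \<beta>) / 2 - 1) * Gamma ((n + \<beta>) / 2) / A powr ((n + \<beta>) / 2))
        = ennreal (C * (2 powr ((n + \<beta>) / 2 - 1) * Gamma ((n + \<beta>) / 2) / A powr ((n + \<beta>) / 2)))"
      using Gp C0 by (subst ennreal_mult) auto
    \<comment> \<open>The powers of 2 from the half-line law and from the Gamma integral multiply to
      2 powr (n / 2), which cancels the one in the Gaussian normalisation.\<close>
    also have "C * (2 powr ((n + \<beta>) / 2 - 1) * Gamma ((n + \<beta>) / 2) / A powr ((n + \<beta>) / 2)) =
        Gamma ((real n + \<beta>) / 2) / (pi powr (real n / 2) * Gamma (\<beta> / 2)) * (1 / A powr ((real n + \<beta>) / 2))"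
    proof -
      have "(sqrt (2 * pi)) ^ n = (2 * pi) powr (n / 2)"
        by (simp add: powr_half_sqrt[symmetric] powr_realpow[symmetric] powr_powr)
      also have "\<dots> = 2 powr (n / 2) * pi powr (n / 2)" by (simp add: powr_mult)
      finally have 1: "(1 / sqrt (2 * pi)) ^ n = 1 / (2 powr (n / 2) * pi powr (n / 2))"
        by (simp add: power_one_over)
      have 2: "2 powr (1 - \<beta> / 2) * 2 powr ((n + \<beta>) / 2 - 1) = 2 powr (n / 2)"
        by (simp add: powr_add[symmetric] add_divide_distrib)
      have "C * (2 powr ((n + \<beta>) / 2 - 1) * Gamma ((n + \<beta>) / 2) / A powr ((n + \<beta>) / 2)) =
        (2 powr (1 - \<beta> / 2) * 2 powr ((n + \<beta>) / 2 - 1)) / (2 powr (n / 2) * pi powr (n / 2)) / Gamma (\<beta> / 2) *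
        (Gamma ((n + \<beta>) / 2) / A powr ((n + \<beta>) / 2))"
        unfolding C_def 1 by (simp add: mult.commute mult.left_commute)
      then show ?thesis unfolding 2 by simp
    qed
    finally show "(\<integral>\<^sup>+t. ennreal (d t) * (ennreal (k t x) * indicator S x) \<partial>lborel) = ennreal (
     Gamma ((real n + \<beta>) / 2) / (pi powr (real n / 2) * Gamma (\<beta> / 2)) *
     (1 / (1 + (L2_set x I)\<^sup>2) powr ((real n + \<beta>) / 2))) * indicator S x" by (simp add: A_def)
  qed
  also have "\<dots> = emeasure (nu_Rn n \<beta>) S"
    unfolding nu_Rn_def L I_def[symmetric]
    by (rule emeasure_density[symmetric]) (auto simp: L2_set_def)
  finally show "emeasure (nu_Rn n \<beta>) S =
      emeasure (distr (nu_half_line \<beta> \<Otimes>\<^sub>M gauss {..<n}) (lebesgue_Rn n) (\<lambda>(t, z). \<lambda>i\<in>{..<n}. t * z i)) S"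
    by (simp add: L I_def)
qed

section \<open>Means over Gaussian vectors\<close>

lemma norm_iexp_diff_le: "cmod (iexp u - iexp v) \<le> \<bar>u - v\<bar>"
proof -
  have "iexp u = iexp v * iexp (u - v)"
    by (simp add: exp_add[symmetric] algebra_simps)
  then have "iexp u - iexp v = iexp v * (iexp (u - v) - 1)"
    by (simp add: algebra_simps)
  then have "cmod (iexp u - iexp v) = cmod (iexp (u - v) - 1)" by (simp add: norm_mult)
  also have "\<dots> \<le> \<bar>u - v\<bar>" using iexp_approx1[of "u - v" 0] by simp
  finally show ?thesis .
qed

lemma has_bochner_integral_gauss_norm_sq:
  assumes I: "finite I"
  shows "has_bochner_integral (gauss I) (\<lambda>x. (L2_set x I)\<^sup>2) (real (card I))"
proof -
  have "has_bochner_integral (gauss I) (\<lambda>x. (x i)\<^sup>2) 1" if "i \<in> I" for i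
    using integrable_gauss_component[OF that, of "\<lambda>x. x ^ 2"] integral_gauss_component[OF that, of "\<lambda>x. x ^ 2"]
      std_normal_distribution_even_moments[of 1] by (simp add: has_bochner_integral_iff)
  then have "has_bochner_integral (gauss I) (\<lambda>x. \<Sum>i\<in>I. (x i)\<^sup>2) (\<Sum>i\<in>I. 1)"
    by (intro has_bochner_integral_sum)
  then show ?thesis by (simp add: L2_set_power2)
qed

text \<open>Nonnegativity of the variance bounds the squared mean of the norm by its second moment,
  which is the dimension. This is what matches the Lipschitz constant
  \<open>1 / sqrt n\<close>.\<close>

lemma
  assumes I: "finite I"
  shows integrable_gauss_norm: "integrable (gauss I) (\<lambda>x. L2_set x I)"
    and integral_gauss_norm_le: "(\<integral>x. L2_set x I \<partial>gauss I) \<le> sqrt (card I)"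
proof -
  interpret G: prob_space "gauss I" by (rule prob_space_gauss)
  note sq = has_bochner_integral_gauss_norm_sq[OF I]
  have m[measurable]: "(\<lambda>x. L2_set x I) \<in> borel_measurable (gauss I)" unfolding L2_set_def by measurable
  show int: "integrable (gauss I) (\<lambda>x. L2_set x I)"
  proof (rule Bochner_Integration.integrable_bound)
    show "integrable (gauss I) (\<lambda>x. (L2_set x I)\<^sup>2 + 1)" using sq by (simp add: has_bochner_integral_iff)
    have "a \<le> a\<^sup>2 + 1" for a :: real using zero_le_power2[of "a - 1 / 2"] by (simp add: power2_diff power_divide)
    then show "AE x in gauss I. norm (L2_set x I) \<le> norm ((L2_set x I)\<^sup>2 + 1)" by simp
  qed (rule m)
  have "(\<integral>x. L2_set x I \<partial>gauss I)\<^sup>2 \<le> (\<integral>x. (L2_set x I)\<^sup>2 \<partial>gauss I)"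
    using G.variance_eq[OF int] sq G.variance_positive[of "\<lambda>x. L2_set x I"] by (simp add: has_bochner_integral_iff)
  then show "(\<integral>x. L2_set x I \<partial>gauss I) \<le> sqrt (card I)"
    using sq by (simp add: has_bochner_integral_iff real_le_rsqrt)
qed

section \<open>Concentration about the mean for Lipschitz constant L\<close>

context
  fixes I :: "'i::countable set" and H :: "('i \<Rightarrow> real) \<Rightarrow> real" and L :: real
  assumes I: "finite I" and H: "\<And>x y. \<bar>H x - H y\<bar> \<le> L * L2_set (\<lambda>i. x i - y i) I" and L: "0 < L"
begin

interpretation G: prob_space "gauss I" by (rule prob_space_gauss)

lemma lip1_divide: "lip1 I (\<lambda>x. H x / L)"
  using H L by (simp add: lip1_def diff_divide_distrib[symmetric] abs_divide divide_le_eq mult.commute)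

lemma scaled_lip_measurable [measurable]: "H \<in> borel_measurable (PiM I (\<lambda>_. lborel))"
proof -
  have "(\<lambda>x. L * (H x / L)) \<in> borel_measurable (PiM I (\<lambda>_. lborel))"
    using lip1_measurable[OF lip1_divide] by measurable
  then show ?thesis using L by simp
qed

lemma integrable_gauss_lip: "integrable (gauss I) H"
proof (rule Bochner_Integration.integrable_bound)
  show "integrable (gauss I) (\<lambda>x. \<bar>H (\<lambda>_. 0)\<bar> + L * L2_set x I)"
    using integrable_gauss_norm[OF I] by simp
  have "\<bar>H x\<bar> \<le> \<bar>H (\<lambda>_. 0)\<bar> + L * L2_set x I" for x
    using H[of x "\<lambda>_. 0"] by simp
  then show "AE x in gauss I. norm (H x) \<le> norm (\<bar>H (\<lambda>_. 0)\<bar> + L * L2_set x I)"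
    by (intro AE_I2) (simp add: order_trans[OF _ abs_ge_self])
qed measurable

text \<open>The deviation of \<open>H x\<close> from the mean is the average of
  \<open>H x - H y\<close> over an independent y, so the two-point bound for \<open>H / L\<close>
  controls it.\<close>

lemma gauss_concentration_mean:
  "(\<integral>\<^sup>+x. ennreal \<bar>H x - (\<integral>y. H y \<partial>gauss I)\<bar> \<partial>gauss I) \<le> ennreal (200 * L)"
proof -
  have "ennreal \<bar>H x - (\<integral>y. H y \<partial>gauss I)\<bar> \<le> (\<integral>\<^sup>+y. ennreal \<bar>H x - H y\<bar> \<partial>gauss I)" for x
  proof -
    have int: "integrable (gauss I) (\<lambda>y. H x - H y)" using integrable_gauss_lip by simp
    have "(\<integral>y. H x - H y \<partial>gauss I) = H x - (\<integral>y. H y \<partial>gauss I)"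
      using integrable_gauss_lip by (simp add: G.prob_space)
    with integral_norm_bound_ennreal[OF int] show ?thesis by simp
  qed
  then have "(\<integral>\<^sup>+x. ennreal \<bar>H x - (\<integral>y. H y \<partial>gauss I)\<bar> \<partial>gauss I) \<le>
      (\<integral>\<^sup>+x. \<integral>\<^sup>+y. ennreal \<bar>H x - H y\<bar> \<partial>gauss I \<partial>gauss I)"
    by (intro nn_integral_mono)
  also have "\<dots> = (\<integral>\<^sup>+x. ennreal L * (\<integral>\<^sup>+y. ennreal \<bar>H x / L - H y / L\<bar> \<partial>gauss I) \<partial>gauss I)"
  proof (intro nn_integral_cong)
    fix x
    have "ennreal \<bar>H x - H y\<bar> = ennreal L * ennreal \<bar>H x / L - H y / L\<bar>" for y
      using L by (simp add: ennreal_mult[symmetric] diff_divide_distrib[symmetric] abs_divide)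
    then show "(\<integral>\<^sup>+y. ennreal \<bar>H x - H y\<bar> \<partial>gauss I) = ennreal L * (\<integral>\<^sup>+y. ennreal \<bar>H x / L - H y / L\<bar> \<partial>gauss I)"
      by (simp add: nn_integral_cmult)
  qed
  also have "\<dots> = ennreal L * (\<integral>\<^sup>+x. \<integral>\<^sup>+y. ennreal \<bar>H x / L - H y / L\<bar> \<partial>gauss I \<partial>gauss I)"
    by (intro nn_integral_cmult) measurable
  also have "\<dots> \<le> ennreal L * 200"
    by (intro mult_left_mono gauss_concentration[OF I lip1_divide]) simp
  also have "\<dots> = ennreal (200 * L)" using L by (simp add: ennreal_mult mult.commute)
  finally show ?thesis .
qed

text \<open>As a function of u, \<open>iexp (s * u)\<close> is \<bar>s\<bar>-Lipschitz, so replacing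
  H by its mean costs at most \<bar>s\<bar> times the mean deviation.\<close>

lemma iexp_gauss_concentration:
  "cmod ((CLINT x|gauss I. iexp (s * H x)) - iexp (s * (\<integral>x. H x \<partial>gauss I))) \<le> \<bar>s\<bar> * (200 * L)"
proof -
  let ?a = "\<integral>x. H x \<partial>gauss I"
  have int: "integrable (gauss I) (\<lambda>x. iexp (s * H x))" by (rule G.integrable_iexp) auto
  then have "(CLINT x|gauss I. iexp (s * H x)) - iexp (s * ?a) = (CLINT x|gauss I. iexp (s * H x) - iexp (s * ?a))"
    by (simp add: G.prob_space)
  then have "ennreal (cmod ((CLINT x|gauss I. iexp (s * H x)) - iexp (s * ?a))) \<le>
      (\<integral>\<^sup>+x. ennreal (cmod (iexp (s * H x) - iexp (s * ?a))) \<partial>gauss I)"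
    using integral_norm_bound_ennreal[of "gauss I" "\<lambda>x. iexp (s * H x) - iexp (s * ?a)"] int by simp
  also have "\<dots> \<le> (\<integral>\<^sup>+x. ennreal \<bar>s\<bar> * ennreal \<bar>H x - ?a\<bar> \<partial>gauss I)"
  proof (intro nn_integral_mono)
    fix x
    have "cmod (iexp (s * H x) - iexp (s * ?a)) \<le> \<bar>s * H x - s * ?a\<bar>" by (rule norm_iexp_diff_le)
    also have "\<dots> = \<bar>s\<bar> * \<bar>H x - ?a\<bar>" by (simp add: abs_mult[symmetric] algebra_simps)
    finally show "ennreal (cmod (iexp (s * H x) - iexp (s * ?a))) \<le> ennreal \<bar>s\<bar> * ennreal \<bar>H x - ?a\<bar>"
      by (simp add: ennreal_mult[symmetric] del: of_real_mult)
  qed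
  also have "\<dots> = ennreal \<bar>s\<bar> * (\<integral>\<^sup>+x. ennreal \<bar>H x - ?a\<bar> \<partial>gauss I)" by (intro nn_integral_cmult) measurable
  also have "\<dots> \<le> ennreal \<bar>s\<bar> * ennreal (200 * L)" by (intro mult_left_mono gauss_concentration_mean) simp
  also have "\<dots> = ennreal (\<bar>s\<bar> * (200 * L))" using L by (simp add: ennreal_mult)
  finally show ?thesis using L by (simp add: ennreal_le_iff)
qed

end

text \<open>Extending f to all functions by forgetting the coordinates from n on lets vectors such
  as \<open>\<lambda>i. t * z i\<close> be used without restriction.\<close>

definition ext_Rn :: "nat \<Rightarrow> ((nat \<Rightarrow> real) \<Rightarrow> real) \<Rightarrow> (nat \<Rightarrow> real) \<Rightarrow> real" where
  "ext_Rn n f x = f (restrict x {..<n})"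

definition mean_Rn :: "nat \<Rightarrow> ((nat \<Rightarrow> real) \<Rightarrow> real) \<Rightarrow> real \<Rightarrow> real" where
  "mean_Rn n f t = (\<integral>z. ext_Rn n f (\<lambda>i. t * z i) \<partial>gauss {..<n})"

section \<open>Averages of the given functions at a fixed scale\<close>

context
  fixes n :: nat and f :: "(nat \<Rightarrow> real) \<Rightarrow> real"
  assumes n: "n \<ge> 1" and f: "lipschitz_Rn n (1 / sqrt (real n)) f"
begin

interpretation G: prob_space "gauss {..<n}" by (rule prob_space_gauss)

lemma ext_Rn_lip: "\<bar>ext_Rn n f x - ext_Rn n f y\<bar> \<le> 1 / sqrt n * L2_set (\<lambda>i. x i - y i) {..<n}"
proof -
  have "\<bar>f (restrict x {..<n}) - f (restrict y {..<n})\<bar> \<le>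
      1 / sqrt n * L2_set (\<lambda>i. restrict x {..<n} i - restrict y {..<n} i) {..<n}"
  proof -
    have R: "restrict x {..<n} \<in> {..<n} \<rightarrow>\<^sub>E UNIV" for x :: "nat \<Rightarrow> real" by simp
    show ?thesis by (rule bspec[OF bspec[OF conjunct2[OF f[unfolded lipschitz_Rn_def]] R] R])
  qed
  also have "L2_set (\<lambda>i. restrict x {..<n} i - restrict y {..<n} i) {..<n} = L2_set (\<lambda>i. x i - y i) {..<n}"
    by (rule L2_set_cong) auto
  finally show ?thesis unfolding ext_Rn_def .
qed

lemma ext_Rn_eq: "x \<in> space (lebesgue_Rn n) \<Longrightarrow> ext_Rn n f x = f x"
  by (simp add: ext_Rn_def lebesgue_Rn_def space_PiM)

lemma ext_Rn_measurable [measurable]: "ext_Rn n f \<in> borel_measurable (PiM {..<n} (\<lambda>_. lborel))"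
  by (rule scaled_lip_measurable[OF _ ext_Rn_lip]) (use n in auto)

lemma lipschitz_Rn_measurable [measurable]: "f \<in> borel_measurable (lebesgue_Rn n)"
proof -
  have "ext_Rn n f \<in> borel_measurable (lebesgue_Rn n) \<longleftrightarrow> f \<in> borel_measurable (lebesgue_Rn n)"
    by (rule measurable_cong) (rule ext_Rn_eq)
  then show ?thesis using ext_Rn_measurable by (simp add: lebesgue_Rn_def)
qed

text \<open>The constant uses \<bar>t\<bar> + 1 instead of \<bar>t\<bar> so that it stays strictly
  positive at t = 0, as the concentration bound divides by it.\<close>

lemma ext_Rn_scale_lip:
  "\<bar>ext_Rn n f (\<lambda>i. t * x i) - ext_Rn n f (\<lambda>i. t * y i)\<bar> \<le> (\<bar>t\<bar> + 1) / sqrt n * L2_set (\<lambda>i. x i - y i) {..<n}"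
proof -
  have "L2_set (\<lambda>i. t * x i - t * y i) {..<n} = \<bar>t\<bar> * L2_set (\<lambda>i. x i - y i) {..<n}"
    unfolding L2_set_right_distrib[OF abs_ge_zero]
    by (simp add: L2_set_def right_diff_distrib[symmetric] power_mult_distrib)
  also have "\<dots> \<le> (\<bar>t\<bar> + 1) * L2_set (\<lambda>i. x i - y i) {..<n}"
    by (intro mult_right_mono) auto
  finally have "L2_set (\<lambda>i. t * x i - t * y i) {..<n} \<le> (\<bar>t\<bar> + 1) * L2_set (\<lambda>i. x i - y i) {..<n}" .
  from mult_left_mono[OF this, of "1 / sqrt n"] show ?thesis
    using ext_Rn_lip[of "\<lambda>i. t * x i" "\<lambda>i. t * y i"] by simp
qed

lemma scale_pos: "0 < (\<bar>t\<bar> + 1) / sqrt n"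
  using n by (simp add: add_nonneg_pos)

lemma integrable_ext_Rn_scale: "integrable (gauss {..<n}) (\<lambda>z. ext_Rn n f (\<lambda>i. t * z i))"
  by (rule integrable_gauss_lip[OF finite_lessThan ext_Rn_scale_lip scale_pos])

text \<open>Both scales are compared on the same z: the values differ by at most
  \<open>\<bar>t - u\<bar> / sqrt n\<close> times the norm of z, whose mean is at most
  \<open>sqrt n\<close>.\<close>

lemma mean_Rn_lip: "\<bar>mean_Rn n f t - mean_Rn n f u\<bar> \<le> \<bar>t - u\<bar>"
proof -
  note int = integrable_ext_Rn_scale
  have "\<bar>mean_Rn n f t - mean_Rn n f u\<bar> = \<bar>\<integral>z. ext_Rn n f (\<lambda>i. t * z i) - ext_Rn n f (\<lambda>i. u * z i) \<partial>gauss {..<n}\<bar>"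
    unfolding mean_Rn_def using int by simp
  also have "\<dots> \<le> (\<integral>z. \<bar>ext_Rn n f (\<lambda>i. t * z i) - ext_Rn n f (\<lambda>i. u * z i)\<bar> \<partial>gauss {..<n})"
    by (rule integral_abs_bound)
  also have "\<dots> \<le> (\<integral>z. (\<bar>t - u\<bar> / sqrt n) * L2_set z {..<n} \<partial>gauss {..<n})"
  proof (rule integral_mono)
    show "integrable (gauss {..<n}) (\<lambda>z. (\<bar>t - u\<bar> / sqrt n) * L2_set z {..<n})"
      by (intro Bochner_Integration.integrable_mult_right integrable_gauss_norm) simp
    fix z
    have "L2_set (\<lambda>i. t * z i - u * z i) {..<n} = \<bar>t - u\<bar> * L2_set z {..<n}"
      unfolding L2_set_right_distrib[OF abs_ge_zero]
      by (simp add: L2_set_def left_diff_distrib[symmetric] power_mult_distrib)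
    then show "\<bar>ext_Rn n f (\<lambda>i. t * z i) - ext_Rn n f (\<lambda>i. u * z i)\<bar> \<le> (\<bar>t - u\<bar> / sqrt n) * L2_set z {..<n}"
      using ext_Rn_lip[of "\<lambda>i. t * z i" "\<lambda>i. u * z i"] by simp
  qed (use int in auto)
  also have "\<dots> = (\<bar>t - u\<bar> / sqrt n) * (\<integral>z. L2_set z {..<n} \<partial>gauss {..<n})" by simp
  also have "\<dots> \<le> (\<bar>t - u\<bar> / sqrt n) * sqrt n"
    using integral_gauss_norm_le[of "{..<n}"] by (intro mult_left_mono) auto
  finally show ?thesis using n by simp
qed

lemma iexp_mean_Rn:
  "cmod ((CLINT z|gauss {..<n}. iexp (s * ext_Rn n f (\<lambda>i. t * z i))) - iexp (s * mean_Rn n f t)) \<le> \<bar>s\<bar> * (200 * ((\<bar>t\<bar> + 1) / sqrt n))"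
  unfolding mean_Rn_def
  by (rule iexp_gauss_concentration[OF finite_lessThan ext_Rn_scale_lip scale_pos])

text \<open>
  Since \<open>1 + b\<^sup>2 \<le> 2 (1 + u\<^sup>2) (1 + (u - b)\<^sup>2)\<close>, mass of the laws cannot stay near the origin when
  the values at \<open>0\<close> are unbounded.
\<close>

lemma ext_Rn_bump_bound:
  "(\<integral>z. 1 / (1 + (ext_Rn n f (\<lambda>i. t * z i))\<^sup>2) \<partial>gauss {..<n}) \<le> 2 * (1 + t\<^sup>2) / (1 + (ext_Rn n f (\<lambda>_. 0))\<^sup>2)"
proof -
  let ?b = "ext_Rn n f (\<lambda>_. 0)" and ?u = "\<lambda>z. ext_Rn n f (\<lambda>i. t * z i)" and ?N = "\<lambda>z. (L2_set z {..<n})\<^sup>2"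
  have sq: "has_bochner_integral (gauss {..<n}) ?N n"
    using has_bochner_integral_gauss_norm_sq[of "{..<n}"] by simp
  \<comment> \<open>The value moves away from that at the origin by at most
    \<open>\<bar>t\<bar> / sqrt n\<close> times the norm of z. The squared norm has mean n, so
    integrating this bound leaves 1 + t^2.\<close>
  have bound: "1 / (1 + (?u z)\<^sup>2) \<le> 2 / (1 + ?b\<^sup>2) * (1 + t\<^sup>2 / n * ?N z)" for z
  proof -
    define v where "v = ?u z - ?b"
    have "\<bar>v\<bar> \<le> 1 / sqrt n * L2_set (\<lambda>i. t * z i) {..<n}"
      using ext_Rn_lip[of "\<lambda>i. t * z i" "\<lambda>_. 0"] by (simp add: v_def)
    then have "\<bar>v\<bar>\<^sup>2 \<le> (1 / sqrt n * L2_set (\<lambda>i. t * z i) {..<n})\<^sup>2" by (intro power_mono) auto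
    also have "\<dots> = t\<^sup>2 / n * ?N z"
      by (simp add: power_mult_distrib power_divide L2_set_power2 sum_distrib_left sum_divide_distrib)
    finally have v: "v\<^sup>2 \<le> t\<^sup>2 / n * ?N z" by simp
    have "1 + ?b\<^sup>2 \<le> 2 * (1 + (?u z)\<^sup>2) * (1 + v\<^sup>2)"
    proof -
      have "?b\<^sup>2 = (?u z - v)\<^sup>2" by (simp add: v_def)
      also have "\<dots> \<le> 2 * (?u z)\<^sup>2 + 2 * v\<^sup>2"
        using zero_le_power2[of "?u z + v"] by (simp add: power2_eq_square algebra_simps)
      also have "\<dots> \<le> 2 * (1 + (?u z)\<^sup>2) * (1 + v\<^sup>2) - 1"
        by (simp add: algebra_simps)
      finally show ?thesis by simp
    qed
    also have "\<dots> \<le> 2 * (1 + (?u z)\<^sup>2) * (1 + t\<^sup>2 / n * ?N z)"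
      by (intro mult_left_mono add_left_mono v) simp
    finally have *: "1 + ?b\<^sup>2 \<le> 2 * (1 + (?u z)\<^sup>2) * (1 + t\<^sup>2 / n * ?N z)" .
    have pos: "0 < 1 + ?b\<^sup>2" "0 < 1 + (?u z)\<^sup>2" by (auto simp: add_pos_nonneg)
    have "1 / (1 + (?u z)\<^sup>2) = (1 + ?b\<^sup>2) / ((1 + ?b\<^sup>2) * (1 + (?u z)\<^sup>2))" using pos by simp
    also have "\<dots> \<le> (2 * (1 + (?u z)\<^sup>2) * (1 + t\<^sup>2 / n * ?N z)) / ((1 + ?b\<^sup>2) * (1 + (?u z)\<^sup>2))"
      using pos by (intro divide_right_mono *) simp
    also have "\<dots> = 2 / (1 + ?b\<^sup>2) * (1 + t\<^sup>2 / n * ?N z)"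
    proof -
      have "(2 * a * k) / (c * a) = 2 / c * k" if "0 < a" for a c k :: real using that by simp
      from this[OF pos(2)] show ?thesis .
    qed
    finally show ?thesis .
  qed
  have hb: "has_bochner_integral (gauss {..<n}) (\<lambda>z. 2 / (1 + ?b\<^sup>2) * (1 + t\<^sup>2 / n * ?N z)) (2 / (1 + ?b\<^sup>2) * (1 + t\<^sup>2 / n * n))"
  proof (intro has_bochner_integral_mult_right has_bochner_integral_add sq)
    show "has_bochner_integral (gauss {..<n}) (\<lambda>y. 1) (1 :: real)"
      by (simp add: has_bochner_integral_iff G.prob_space)
  qed
  have u: "integrable (gauss {..<n}) ?u" by (rule integrable_ext_Rn_scale)
  have "(\<integral>z. 1 / (1 + (?u z)\<^sup>2) \<partial>gauss {..<n}) \<le> (\<integral>z. 2 / (1 + ?b\<^sup>2) * (1 + t\<^sup>2 / n * ?N z) \<partial>gauss {..<n})"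
  proof (rule integral_mono)
    show "integrable (gauss {..<n}) (\<lambda>z. 1 / (1 + (?u z)\<^sup>2))"
      by (rule G.integrable_const_bound[where B=1])
        (use borel_measurable_integrable[OF u] in \<open>auto simp: add_pos_nonneg\<close>)
  qed (use hb bound in \<open>auto simp: has_bochner_integral_iff\<close>)
  also have "\<dots> = 2 * (1 + t\<^sup>2) / (1 + ?b\<^sup>2)"
    using hb n by (simp add: has_bochner_integral_iff)
  finally show ?thesis .
qed

text \<open>This is the mixture representation combined with Fubini. The values of \<psi> lie in a
  Banach space so that both the real test function 1 / (1 + u^2) and complex exponentials are
  covered.\<close>

lemma
  fixes \<psi> :: "real \<Rightarrow> 'b::{banach, second_countable_topology}"
  assumes \<beta>: "\<beta> > 0" and \<psi>[measurable]: "\<psi> \<in> borel_measurable borel" and bd: "\<And>u. norm (\<psi> u) \<le> B"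
  shows integral_nu_Rn: "(\<integral>u. \<psi> u \<partial>distr (nu_Rn n \<beta>) borel f) =
      (\<integral>t. \<integral>z. \<psi> (ext_Rn n f (\<lambda>i. t * z i)) \<partial>gauss {..<n} \<partial>nu_half_line \<beta>)" (is ?A)
    and measurable_inner_integral:
      "(\<lambda>t. \<integral>z. \<psi> (ext_Rn n f (\<lambda>i. t * z i)) \<partial>gauss {..<n}) \<in> borel_measurable (nu_half_line \<beta>)" (is ?B)
proof -
  interpret V: prob_space "nu_half_line \<beta>" by (rule prob_space_nu_half_line[OF \<beta>])
  interpret P: pair_prob_space "nu_half_line \<beta>" "gauss {..<n}" ..
  let ?s = "\<lambda>(t, z). \<lambda>i\<in>{..<n}. t * z i"
  let ?k = "\<lambda>(t, z). \<psi> (ext_Rn n f (\<lambda>i. t * z i))"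
  have s: "?s \<in> measurable (nu_half_line \<beta> \<Otimes>\<^sub>M gauss {..<n}) (lebesgue_Rn n)"
    using measurable_scale_mixture[of "{..<n}" \<beta>] by (simp add: lebesgue_Rn_def)
  have e: "\<psi> (ext_Rn n f (\<lambda>i. t * z i)) = \<psi> (f (\<lambda>i\<in>{..<n}. t * z i))" for t z
    by (simp add: ext_Rn_def)
  have k: "?k = (\<lambda>p. \<psi> (f (?s p)))" by (auto simp: e)
  have km[measurable]: "?k \<in> borel_measurable (nu_half_line \<beta> \<Otimes>\<^sub>M gauss {..<n})"
    unfolding k using s lipschitz_Rn_measurable \<psi> by (intro measurable_compose[OF s] measurable_compose[OF lipschitz_Rn_measurable])
  have ki: "integrable (nu_half_line \<beta> \<Otimes>\<^sub>M gauss {..<n}) ?k"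
    by (rule P.integrable_const_bound[where B=B]) (use bd km in auto)
  have fm: "f \<in> borel_measurable (nu_Rn n \<beta>)" by (simp add: nu_Rn_def)
  have "(\<integral>u. \<psi> u \<partial>distr (nu_Rn n \<beta>) borel f) = (\<integral>x. \<psi> (f x) \<partial>nu_Rn n \<beta>)"
    by (rule integral_distr[OF fm \<psi>])
  also have "\<dots> = (\<integral>p. \<psi> (f (?s p)) \<partial>(nu_half_line \<beta> \<Otimes>\<^sub>M gauss {..<n}))"
    unfolding nu_Rn_eq_mixture[OF \<beta>] by (rule integral_distr[OF s]) measurable
  also have "\<dots> = (\<integral>t. \<integral>z. ?k (t, z) \<partial>gauss {..<n} \<partial>nu_half_line \<beta>)"
    using P.integral_fst'[OF ki] unfolding k by simp
  finally show ?A by simp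
  show ?B by (rule G.borel_measurable_lebesgue_integral[OF km])
qed

lemma real_distribution_nu_Rn:
  assumes \<beta>: "\<beta> > 0"
  shows "real_distribution (distr (nu_Rn n \<beta>) borel f)"
proof -
  interpret V: prob_space "nu_half_line \<beta>" by (rule prob_space_nu_half_line[OF \<beta>])
  interpret P: pair_prob_space "nu_half_line \<beta>" "gauss {..<n}" ..
  have "prob_space (nu_Rn n \<beta>)"
    unfolding nu_Rn_eq_mixture[OF \<beta>] using measurable_scale_mixture[of "{..<n}" \<beta>]
    by (intro P.prob_space_distr) (simp add: lebesgue_Rn_def)
  moreover have "f \<in> borel_measurable (nu_Rn n \<beta>)" by (simp add: nu_Rn_def)
  ultimately have "prob_space (distr (nu_Rn n \<beta>) borel f)" by (intro prob_space.prob_space_distr)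
  then show ?thesis by (simp add: real_distribution_def real_distribution_axioms_def)
qed

end

section \<open>The limit\<close>

text \<open>A diagonal argument gives convergence at all rationals, and the common Lipschitz
  constant carries the Cauchy property to every real point.\<close>

lemma lipschitz_convergent_subsequence:
  fixes A :: "nat \<Rightarrow> real \<Rightarrow> real"
  assumes lip: "\<And>i t u. \<bar>A i t - A i u\<bar> \<le> \<bar>t - u\<bar>" and bd: "\<And>i. \<bar>A i 0\<bar> \<le> B"
  obtains k \<alpha> where "strict_mono (k :: nat \<Rightarrow> nat)" "\<And>t. (\<lambda>i. A (k i) t) \<longlonglongrightarrow> \<alpha> t"
    "\<And>t u. \<bar>\<alpha> t - \<alpha> u\<bar> \<le> \<bar>t - u\<bar>"
proof -
  have B: "0 \<le> B" using bd[of 0] by linarith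
  \<comment> \<open>The diagonal extraction needs one bound for all points, so the linearly growing
    functions are divided by 1 + \<bar>t\<bar>; the weight is removed afterwards.\<close>
  have bd': "norm (A i t / (1 + \<bar>t\<bar>)) \<le> B + 1" for i t
  proof -
    have "\<bar>A i t\<bar> \<le> B + \<bar>t\<bar>" using bd[of i] lip[of i t 0] by linarith
    also have "\<dots> \<le> (B + 1) * (1 + \<bar>t\<bar>)" using B by (simp add: algebra_simps)
    finally show ?thesis by (simp add: divide_le_eq abs_divide)
  qed
  obtain k where k: "strict_mono (k :: nat \<Rightarrow> nat)"
    and conv: "\<And>q. q \<in> \<rat> \<Longrightarrow> \<exists>l. (\<lambda>i. A (k i) q / (1 + \<bar>q\<bar>)) \<longlonglongrightarrow> l"
    using function_convergent_subsequence[OF countable_rat, of "\<lambda>i t. A i t / (1 + \<bar>t\<bar>)" "B + 1"] bd' by blast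
  have rat: "Cauchy (\<lambda>i. A (k i) q)" if q: "q \<in> \<rat>" for q
  proof -
    from conv[OF q] obtain l where "(\<lambda>i. A (k i) q / (1 + \<bar>q\<bar>)) \<longlonglongrightarrow> l" by blast
    then have "(\<lambda>i. A (k i) q / (1 + \<bar>q\<bar>) * (1 + \<bar>q\<bar>)) \<longlonglongrightarrow> l * (1 + \<bar>q\<bar>)" by (intro tendsto_intros)
    moreover have "1 + \<bar>q\<bar> \<noteq> 0" by linarith
    ultimately show ?thesis by (intro LIMSEQ_imp_Cauchy) simp
  qed
  have "convergent (\<lambda>i. A (k i) t)" for t
  proof -
    have "Cauchy (\<lambda>i. A (k i) t)"
    proof (rule metric_CauchyI)
      fix e :: real assume e: "0 < e"
      obtain q where q: "q \<in> \<rat>" "t < q" "q < t + e / 3"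
        using Rats_dense_in_real[of t "t + e / 3"] e by auto
      from metric_CauchyD[OF rat[OF q(1)], of "e / 3"] e obtain N
        where N: "\<And>m n. m \<ge> N \<Longrightarrow> n \<ge> N \<Longrightarrow> dist (A (k m) q) (A (k n) q) < e / 3" by auto
      show "\<exists>N. \<forall>m\<ge>N. \<forall>n\<ge>N. dist (A (k m) t) (A (k n) t) < e"
      proof (intro exI allI impI)
        fix m n assume "N \<le> m" "N \<le> n"
        from N[OF this] lip[of "k m" t q] lip[of "k n" t q] q
        show "dist (A (k m) t) (A (k n) t) < e" unfolding dist_real_def by linarith
      qed
    qed
    then show ?thesis by (simp add: Cauchy_convergent_iff)
  qed
  then obtain \<alpha> where \<alpha>: "\<And>t. (\<lambda>i. A (k i) t) \<longlonglongrightarrow> \<alpha> t" unfolding convergent_def by metis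
  have "\<bar>\<alpha> t - \<alpha> u\<bar> \<le> \<bar>t - u\<bar>" for t u
    by (rule LIMSEQ_le_const2[OF tendsto_rabs[OF tendsto_diff[OF \<alpha> \<alpha>]]]) (use lip in auto)
  with k \<alpha> show thesis by (rule that)
qed

text \<open>Weak convergence is tested on 1 / (1 + u^2). Its integral against \<mu> is positive,
  since \<mu> has mass one, whereas a large value at the origin would make the approximating
  integral small.\<close>

lemma ext_Rn_origin_bounded:
  fixes \<beta> :: real
    and f :: "nat \<Rightarrow> (nat \<Rightarrow> real) \<Rightarrow> real"
    and r :: "nat \<Rightarrow> nat"
    and \<mu> :: "real measure"
  assumes \<beta>: "\<beta> > 0"
    and f: "\<And>n. n \<ge> 1 \<Longrightarrow> lipschitz_Rn n (1 / sqrt (real n)) (f n)"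
    and r: "\<And>i. r i \<ge> 1"
    and \<mu>: "real_distribution \<mu>"
    and conv: "weak_conv_m (\<lambda>i. distr (nu_Rn (r i) \<beta>) borel (f (r i))) \<mu>"
  obtains B where "\<And>i. \<bar>ext_Rn (r i) (f (r i)) (\<lambda>_. 0)\<bar> \<le> B"
proof -
  interpret \<mu>: real_distribution \<mu> by fact
  interpret V: prob_space "nu_half_line \<beta>" by (rule prob_space_nu_half_line[OF \<beta>])
  let ?\<psi> = "\<lambda>u :: real. 1 / (1 + u\<^sup>2)"
  let ?M = "\<lambda>i. distr (nu_Rn (r i) \<beta>) borel (f (r i))"
  define b where "b i = ext_Rn (r i) (f (r i)) (\<lambda>_. 0)" for i
  have M: "real_distribution (?M i)" for i
    by (rule real_distribution_nu_Rn[OF r f[OF r] \<beta>])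
  have nz: "1 + u\<^sup>2 \<noteq> 0" for u :: real by (metis add_pos_nonneg less_irrefl zero_le_power2 zero_less_one)
  have \<psi>m[measurable]: "?\<psi> \<in> borel_measurable borel" by measurable
  have \<psi>1: "norm (?\<psi> u) \<le> 1" for u by (simp add: add_pos_nonneg)
  define m where "m = (\<integral>u. ?\<psi> u \<partial>\<mu>)"
  have lim: "(\<lambda>i. \<integral>u. ?\<psi> u \<partial>?M i) \<longlonglongrightarrow> m"
    unfolding m_def
    by (rule weak_conv_imp_integral_bdd_continuous_conv[OF M \<mu> conv, where B=1])
      (use \<psi>1 nz in \<open>auto intro!: continuous_intros\<close>)
  have m: "0 < m"
  proof -
    have "integrable \<mu> ?\<psi>" by (rule \<mu>.integrable_const_bound[where B=1]) (use \<psi>1 in auto)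
    moreover have "AE u in \<mu>. 0 \<le> ?\<psi> u" by (simp add: add_pos_nonneg)
    moreover have "\<not> (AE u in \<mu>. ?\<psi> u = 0)" using nz \<mu>.AE_False by simp
    ultimately show ?thesis
      unfolding m_def using integral_nonneg_eq_0_iff_AE[of \<mu> ?\<psi>] integral_nonneg_AE[of ?\<psi> \<mu>] by linarith
  qed
  \<comment> \<open>K stands for the squared value at the origin. Truncation at 1 supplies a
    dominating function for every \<beta>; 1 + t^2 itself is not integrable for \<beta> \<le>
    2.\<close>
  define h where "h K t = min 1 (2 * (1 + t\<^sup>2) / (1 + K))" for K t :: real
  have "((\<lambda>K. \<integral>t. h K t \<partial>nu_half_line \<beta>) \<longlongrightarrow> (\<integral>t. 0 \<partial>nu_half_line \<beta>)) at_top"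
  proof (rule integral_dominated_convergence_at_top[where w="\<lambda>_. 1"])
    show "AE t in nu_half_line \<beta>. ((\<lambda>K. h K t) \<longlongrightarrow> 0) at_top"
    proof (rule AE_I2)
      fix t :: real
      have "((\<lambda>K. 2 * (1 + t\<^sup>2) / (1 + K)) \<longlongrightarrow> 0) at_top"
        by (intro tendsto_divide_0[OF tendsto_const] filterlim_at_top_imp_at_infinity
            filterlim_tendsto_add_at_top[OF tendsto_const] filterlim_ident)
      then have "((\<lambda>K. min 1 (2 * (1 + t\<^sup>2) / (1 + K))) \<longlongrightarrow> min 1 0) at_top"
        by (intro tendsto_min tendsto_const)
      then show "((\<lambda>K. h K t) \<longlongrightarrow> 0) at_top" by (simp add: h_def)
    qed
    show "\<forall>\<^sub>F K in at_top. AE t in nu_half_line \<beta>. norm (h K t) \<le> 1"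
      using eventually_ge_at_top[of 0] by eventually_elim (auto simp: h_def)
  qed (auto simp: h_def)
  then have "((\<lambda>K. \<integral>t. h K t \<partial>nu_half_line \<beta>) \<longlongrightarrow> 0) at_top" by simp
  from order_tendstoD(2)[OF this, of "m / 2"] m obtain K
    where K: "\<And>L. K \<le> L \<Longrightarrow> (\<integral>t. h L t \<partial>nu_half_line \<beta>) < m / 2"
    by (auto simp: eventually_at_top_linorder)
  have \<psi>h: "(\<integral>u. ?\<psi> u \<partial>?M i) \<le> (\<integral>t. h ((b i)\<^sup>2) t \<partial>nu_half_line \<beta>)" for i
  proof -
    interpret G: prob_space "gauss {..<r i}" by (rule prob_space_gauss)
    let ?J = "\<lambda>t. \<integral>z. ?\<psi> (ext_Rn (r i) (f (r i)) (\<lambda>j. t * z j)) \<partial>gauss {..<r i}"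
    have J0: "0 \<le> ?J t" for t by (intro integral_nonneg_AE AE_I2) (simp add: add_pos_nonneg)
    have J1: "?J t \<le> 1" for t
    proof -
      have "?J t \<le> (\<integral>z. 1 \<partial>gauss {..<r i})"
        by (rule integral_mono') (auto simp: add_pos_nonneg)
      then show ?thesis by (simp add: G.prob_space)
    qed
    have Jh: "?J t \<le> h ((b i)\<^sup>2) t" for t
      unfolding h_def b_def using J1 ext_Rn_bump_bound[OF r f[OF r], of i t] by simp
    have Jm: "?J \<in> borel_measurable (nu_half_line \<beta>)"
      by (rule measurable_inner_integral[OF r f[OF r] \<beta> \<psi>m \<psi>1])
    have "(\<integral>u. ?\<psi> u \<partial>?M i) = (\<integral>t. ?J t \<partial>nu_half_line \<beta>)"
      by (rule integral_nu_Rn[OF r f[OF r] \<beta> \<psi>m \<psi>1])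
    also have "\<dots> \<le> (\<integral>t. h ((b i)\<^sup>2) t \<partial>nu_half_line \<beta>)"
    proof (rule integral_mono)
      show "integrable (nu_half_line \<beta>) ?J"
        by (rule V.integrable_const_bound[where B=1]) (use J0 J1 Jm in auto)
      show "integrable (nu_half_line \<beta>) (h ((b i)\<^sup>2))"
        by (rule V.integrable_const_bound[where B=1]) (auto simp: h_def[abs_def] add_pos_nonneg)
    qed (rule Jh)
    finally show ?thesis .
  qed
  have "\<forall>\<^sub>F i in sequentially. m / 2 < (\<integral>u. ?\<psi> u \<partial>?M i)"
    using lim m by (intro order_tendstoD(1)) auto
  \<comment> \<open>An integral above m / 2 forces \<open>(b i)\<^sup>2\<close> below K, and a \<le>
    a^2 + 1 gives the bound K + 1. The finitely many other indices are absorbed by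
    \<open>Bseq\<close>.\<close>
  then have "\<forall>\<^sub>F i in sequentially. norm (b i) \<le> K + 1"
  proof eventually_elim
    case (elim i)
    then have "(b i)\<^sup>2 < K" using K[of "(b i)\<^sup>2"] \<psi>h[of i] by (intro not_le_imp_less notI) linarith
    moreover have "\<bar>b i\<bar> \<le> (b i)\<^sup>2 + 1"
      using zero_le_power2[of "\<bar>b i\<bar> - 1 / 2"] by (simp add: power2_diff power_divide)
    ultimately show ?case by simp
  qed
  then have "Bseq b" by (rule BfunI)
  then obtain B where "\<And>i. norm (b i) \<le> B" unfolding Bseq_def by blast
  then show thesis by (intro that[of B]) (simp add: b_def)
qed

theorem corollary1p6:
  fixes \<beta> :: real
    and f :: "nat \<Rightarrow> (nat \<Rightarrow> real) \<Rightarrow> real"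
    and r :: "nat \<Rightarrow> nat"
    and \<mu> :: "real measure"
  assumes "\<beta> > 0"
    and "\<And>n. n \<ge> 1 \<Longrightarrow> lipschitz_Rn n (1 / sqrt (real n)) (f n)"
    and "strict_mono r"
    and "\<And>i. r i \<ge> 1"
    and "prob_space \<mu>"
    and "sets \<mu> = sets borel"
    and "weak_conv_m (\<lambda>i. distr (nu_Rn (r i) \<beta>) borel (f (r i))) \<mu>"
  shows "\<exists>\<alpha> :: real \<Rightarrow> real. 1-lipschitz_on {0..} \<alpha> \<and> distr (nu_half_line \<beta>) borel \<alpha> = \<mu>"
proof -
  note \<beta> = assms(1) and f = assms(2) and r = assms(4)
  have \<mu>: "real_distribution \<mu>"
    using assms(5,6) by (simp add: real_distribution_def real_distribution_axioms_def)
  interpret V: prob_space "nu_half_line \<beta>" by (rule prob_space_nu_half_line[OF \<beta>])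
  define A where "A i = mean_Rn (r i) (f (r i))" for i
  obtain B where B: "\<And>i. \<bar>ext_Rn (r i) (f (r i)) (\<lambda>_. 0)\<bar> \<le> B"
    using ext_Rn_origin_bounded[OF \<beta> f r \<mu> assms(7)] by blast
  have lip: "\<bar>A i t - A i u\<bar> \<le> \<bar>t - u\<bar>" for i t u
    unfolding A_def by (rule mean_Rn_lip[OF r f[OF r]])
  \<comment> \<open>At scale 0 the integrand is constant, so the mean is the value at the
    origin.\<close>
  have "A i 0 = ext_Rn (r i) (f (r i)) (\<lambda>_. 0)" for i
    using prob_space.prob_space[OF prob_space_gauss, of "{..<r i}"] by (simp add: A_def mean_Rn_def)
  with B have A0: "\<bar>A i 0\<bar> \<le> B" for i by simp
  obtain k \<alpha> where k: "strict_mono k" and A\<alpha>: "\<And>t. (\<lambda>i. A (k i) t) \<longlonglongrightarrow> \<alpha> t"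
    and \<alpha>: "\<And>t u. \<bar>\<alpha> t - \<alpha> u\<bar> \<le> \<bar>t - u\<bar>"
    by (rule lipschitz_convergent_subsequence[OF lip A0]) (rule that)
  \<comment> \<open>The limit is Lipschitz on the whole line: this gives measurability on
    \<open>UNIV\<close>, and the claim on \<open>{0..}\<close>.\<close>
  have lip\<alpha>: "1-lipschitz_on S \<alpha>" for S
    by (rule lipschitz_onI) (use \<alpha> in \<open>auto simp: dist_real_def\<close>)
  then have \<alpha>m[measurable]: "\<alpha> \<in> borel_measurable borel"
    by (intro borel_measurable_continuous_onI lipschitz_on_continuous_on)
  have law: "real_distribution (distr (nu_half_line \<beta>) borel \<alpha>)"
    using V.prob_space_distr[of \<alpha> borel] by (simp add: real_distribution_def real_distribution_axioms_def)
  let ?M = "\<lambda>i. distr (nu_Rn (r i) \<beta>) borel (f (r i))"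
  have "char (distr (nu_half_line \<beta>) borel \<alpha>) s = char \<mu> s" for s
  proof -
    \<comment> \<open>The characteristic function of the value conditional on the scale t; averaging
      it over t gives that of the push-forward.\<close>
    define X where "X i t = (CLINT z|gauss {..<r i}. iexp (s * ext_Rn (r i) (f (r i)) (\<lambda>j. t * z j)))" for i t
    have meas: "(\<lambda>u. iexp (s * u)) \<in> borel_measurable borel" by measurable
    have bd: "norm (iexp (s * u)) \<le> 1" for u by simp
    have char: "char (?M i) s = (CLINT t|nu_half_line \<beta>. X i t)" for i
      unfolding char_def X_def by (rule integral_nu_Rn[OF r f[OF r] \<beta> meas bd])
    have Xm: "X i \<in> borel_measurable (nu_half_line \<beta>)" for i
      unfolding X_def[abs_def] by (rule measurable_inner_integral[OF r f[OF r] \<beta> meas bd])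
    have X1: "norm (X i t) \<le> 1" for i t
    proof -
      have "norm (X i t) \<le> (\<integral>z. norm (iexp (s * ext_Rn (r i) (f (r i)) (\<lambda>j. t * z j))) \<partial>gauss {..<r i})"
        unfolding X_def by (rule integral_norm_bound)
      then show ?thesis using prob_space.prob_space[OF prob_space_gauss, of "{..<r i}"] by simp
    qed
    have rk: "filterlim (\<lambda>i. r (k i)) at_top sequentially"
      using filterlim_compose[OF filterlim_subseq[OF assms(3)] filterlim_subseq[OF k]] .
    have "(\<lambda>i. X (k i) t) \<longlonglongrightarrow> iexp (s * \<alpha> t)" for t
    proof -
      \<comment> \<open>For fixed t the error of replacing the values by their mean is of order one
        over the square root of the dimension, and the dimension tends to infinity along the
        subsequence.\<close>
      have "(\<lambda>i. \<bar>s\<bar> * (200 * ((\<bar>t\<bar> + 1) / sqrt (r (k i))))) \<longlonglongrightarrow> \<bar>s\<bar> * (200 * 0)"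
        by (intro tendsto_intros tendsto_divide_0[OF tendsto_const] filterlim_at_top_imp_at_infinity
            filterlim_compose[OF sqrt_at_top] filterlim_compose[OF filterlim_real_sequentially] rk)
      then have "(\<lambda>i. \<bar>s\<bar> * (200 * ((\<bar>t\<bar> + 1) / sqrt (r (k i))))) \<longlonglongrightarrow> 0" by simp
      then have "(\<lambda>i. X (k i) t - iexp (s * A (k i) t)) \<longlonglongrightarrow> 0"
        by (rule Lim_null_comparison[rotated])
          (auto simp only: X_def A_def intro!: always_eventually iexp_mean_Rn[OF r f[OF r]])
      moreover have "(\<lambda>i. iexp (s * A (k i) t)) \<longlonglongrightarrow> iexp (s * \<alpha> t)"
        by (intro tendsto_intros A\<alpha>)
      ultimately have "(\<lambda>i. (X (k i) t - iexp (s * A (k i) t)) + iexp (s * A (k i) t)) \<longlonglongrightarrow> 0 + iexp (s * \<alpha> t)"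
        by (rule tendsto_add)
      then show ?thesis by simp
    qed
    then have "(\<lambda>i. CLINT t|nu_half_line \<beta>. X (k i) t) \<longlonglongrightarrow> (CLINT t|nu_half_line \<beta>. iexp (s * \<alpha> t))"
      by (intro integral_dominated_convergence[where w="\<lambda>_. 1"]) (use X1 Xm in auto)
    moreover have "(CLINT t|nu_half_line \<beta>. iexp (s * \<alpha> t)) = char (distr (nu_half_line \<beta>) borel \<alpha>) s"
      unfolding char_def by (rule integral_distr[symmetric]) measurable
    \<comment> \<open>Weak convergence gives this limit along r, hence along the further subsequence
      k. The same sequence has the limit computed by dominated convergence, so the two
      characteristic functions agree.\<close>
    moreover have "(\<lambda>i. char (?M (k i)) s) \<longlonglongrightarrow> char \<mu> s"
      using LIMSEQ_subseq_LIMSEQ[OF levy_continuity1[OF real_distribution_nu_Rn[OF r f[OF r] \<beta>] \<mu> assms(7)] k]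
      by (simp add: o_def)
    ultimately show ?thesis unfolding char by (metis LIMSEQ_unique)
  qed
  then have "distr (nu_half_line \<beta>) borel \<alpha> = \<mu>"
    by (intro Levy_uniqueness law \<mu> ext)
  with lip\<alpha> show ?thesis by blast
qed

end
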